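(* Let $\mathcal E$ be an essentially small idempotent-complete exact category with enough projective objects, and let $$0\longrightarrow X\longrightarrow Y\longrightarrow Z\longrightarrow0$$ be a conflation in $\mathcal E$. Then, for every $k\ge1$, $$k\text{-}\operatorname{ddell}_{\mathcal E}Y\le k\text{-}\operatorname{ddell}_{\mathcal E}X+k\text{-}\operatorname{ddell}_{\mathcal E}Z+1 .$$
   Context: Short exact sequences of the exact structure are called conflations. For each $X\in\mathcal E$ fix a conflation $0\to\Omega_{\mathcal E}X\to P_X\to X\to0$ with $P_X$ projective. The stable category $\underline{\mathcal E}=\mathcal E/[\operatorname{Proj}\mathcal E]$ has morphisms modulo those factoring through projectives, and $\Omega_{\mathcal E}$ is an endofunctor of it. $X$ is a stable retract of $Y$ if there are $u:X\to Y$, $v:Y\to X$ in $\underline{\mathcal E}$ with $vu=1_X$. For $k\ge1$, $$k\text{-}\operatorname{dell}_{\mathcal E}X=\inf\{n\ge0\mid \Omega_{\mathcal E}^nX\text{ is a stable retract of }\Omega_{\mathcal E}^{n+k}Y\text{ for some }Y\in\mathcal E\}.$$ A sequence $0\to C_t\to\cdots\to C_0\to X\to0$ is admissibly exact if there are objects $Z_0=X,Z_1,\dots,Z_t=C_t$ and conflations $0\to Z_{i+1}\to C_i\to Z_i\to0$ for $0\le i<t$ from which it is spliced (for $t=0$: $C_0\to X$ is an isomorphism). $k\text{-}\operatorname{ddell}_{\mathcal E}X$ is the infimum of the integers $m\ge0$ such that there are $0\le t\le m$ and an admissibly exact sequence $0\to C_t\to\cdots\to C_0\to X\to0$ with $(i+k)\text{-}\operatorname{dell}_{\mathcal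 E}C_i\le m-i$ for $0\le i\le t$. ($\inf\emptyset=\infty$.) *)

theory Defs
  imports "HOL-Algebra.Group" "HOL-Library.Extended_Nat"
begin

section \<open>Categories\<close>

text \<open>
  The objects form a subset of a type \<open>'o\<close> and the morphisms live in a type \<open>'m\<close>. Hence every
  category considered here is small relative to the ambient logic; in particular it is essentially
  small, and every essentially small category is equivalent to one of this form.
\<close>

record ('o, 'm) cat =
  Obj :: "'o set"
  Hom :: "'o \<Rightarrow> 'o \<Rightarrow> 'm set"
  Comp :: "'m \<Rightarrow> 'm \<Rightarrow> 'm"  (infixl \<open>\<cdot>\<index>\<close> 70)
  Ident :: "'o \<Rightarrow> 'm"

locale category =
  fixes C :: "('o, 'm, 'z) cat_scheme" (structure)
  assumes Hom_obj: "f \<in> Hom C X Y \<Longrightarrow> X \<in> Obj C \<and> Y \<in> Obj C"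
    and Hom_disjoint: "\<lbrakk>f \<in> Hom C X Y; f \<in> Hom C X' Y'\<rbrakk> \<Longrightarrow> X = X' \<and> Y = Y'"
    and Comp_closed: "\<lbrakk>f \<in> Hom C X Y; g \<in> Hom C Y Z\<rbrakk> \<Longrightarrow> g \<cdot> f \<in> Hom C X Z"
    and Ident_closed: "X \<in> Obj C \<Longrightarrow> Ident C X \<in> Hom C X X"
    and Comp_assoc: "\<lbrakk>f \<in> Hom C W X; g \<in> Hom C X Y; h \<in> Hom C Y Z\<rbrakk> \<Longrightarrow> h \<cdot> g \<cdot> f = h \<cdot> (g \<cdot> f)"
    and Comp_Ident: "f \<in> Hom C X Y \<Longrightarrow> f \<cdot> Ident C X = f"
    and Ident_Comp: "f \<in> Hom C X Y \<Longrightarrow> Ident C Y \<cdot> f = f"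

definition is_iso :: "('o, 'm, 'z) cat_scheme \<Rightarrow> 'o \<Rightarrow> 'o \<Rightarrow> 'm \<Rightarrow> bool" where
  "is_iso C X Y f \<longleftrightarrow> f \<in> Hom C X Y \<and>
     (\<exists>g \<in> Hom C Y X. g \<cdot>\<^bsub>C\<^esub> f = Ident C X \<and> f \<cdot>\<^bsub>C\<^esub> g = Ident C Y)"

definition retract :: "('o, 'm, 'z) cat_scheme \<Rightarrow> 'o \<Rightarrow> 'o \<Rightarrow> bool" where
  "retract C X Y \<longleftrightarrow> X \<in> Obj C \<and> Y \<in> Obj C \<and>
     (\<exists>u \<in> Hom C X Y. \<exists>v \<in> Hom C Y X. v \<cdot>\<^bsub>C\<^esub> u = Ident C X)"

definition idempotent_complete :: "('o, 'm, 'z) cat_scheme \<Rightarrow> bool" where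
  "idempotent_complete C \<longleftrightarrow>
     (\<forall>X \<in> Obj C. \<forall>e \<in> Hom C X X. e \<cdot>\<^bsub>C\<^esub> e = e \<longrightarrow>
       (\<exists>Y \<in> Obj C. \<exists>r \<in> Hom C X Y. \<exists>s \<in> Hom C Y X.
          s \<cdot>\<^bsub>C\<^esub> r = e \<and> r \<cdot>\<^bsub>C\<^esub> s = Ident C Y))"

definition is_pushout :: "('o, 'm, 'z) cat_scheme \<Rightarrow> 'm \<Rightarrow> 'm \<Rightarrow> 'm \<Rightarrow> 'm \<Rightarrow> bool" where
  "is_pushout C i f i' f' \<longleftrightarrow>
     (\<exists>A B A' B'. i \<in> Hom C A B \<and> f \<in> Hom C A A' \<and> i' \<in> Hom C A' B' \<and> f' \<in> Hom C B B' \<and>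
        f' \<cdot>\<^bsub>C\<^esub> i = i' \<cdot>\<^bsub>C\<^esub> f \<and>
        (\<forall>W \<in> Obj C. \<forall>b \<in> Hom C B W. \<forall>a \<in> Hom C A' W. b \<cdot>\<^bsub>C\<^esub> i = a \<cdot>\<^bsub>C\<^esub> f \<longrightarrow>
           (\<exists>!h. h \<in> Hom C B' W \<and> h \<cdot>\<^bsub>C\<^esub> f' = b \<and> h \<cdot>\<^bsub>C\<^esub> i' = a)))"

definition is_pullback :: "('o, 'm, 'z) cat_scheme \<Rightarrow> 'm \<Rightarrow> 'm \<Rightarrow> 'm \<Rightarrow> 'm \<Rightarrow> bool" where
  "is_pullback C p f p' f' \<longleftrightarrow>
     (\<exists>A B A' B'. p \<in> Hom C B A \<and> f \<in> Hom C A' A \<and> p' \<in> Hom C B' A' \<and> f' \<in> Hom C B' B \<and>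
        p \<cdot>\<^bsub>C\<^esub> f' = f \<cdot>\<^bsub>C\<^esub> p' \<and>
        (\<forall>W \<in> Obj C. \<forall>b \<in> Hom C W B. \<forall>a \<in> Hom C W A'. p \<cdot>\<^bsub>C\<^esub> b = f \<cdot>\<^bsub>C\<^esub> a \<longrightarrow>
           (\<exists>!h. h \<in> Hom C W B' \<and> f' \<cdot>\<^bsub>C\<^esub> h = b \<and> p' \<cdot>\<^bsub>C\<^esub> h = a)))"


section \<open>Additive categories\<close>

record ('o, 'm) add_cat = "('o, 'm) cat" +
  Add :: "'m \<Rightarrow> 'm \<Rightarrow> 'm"  (infixl \<open>\<boxplus>\<index>\<close> 65)
  Zero :: "'o \<Rightarrow> 'o \<Rightarrow> 'm"

definition hom_group :: "('o, 'm, 'z) add_cat_scheme \<Rightarrow> 'o \<Rightarrow> 'o \<Rightarrow> 'm monoid" where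
  "hom_group C X Y = \<lparr>carrier = Hom C X Y, mult = Add C, one = Zero C X Y\<rparr>"

definition is_zero_object :: "('o, 'm, 'z) cat_scheme \<Rightarrow> 'o \<Rightarrow> bool" where
  "is_zero_object C N \<longleftrightarrow> N \<in> Obj C \<and>
     (\<forall>X \<in> Obj C. (\<exists>!f. f \<in> Hom C X N) \<and> (\<exists>!f. f \<in> Hom C N X))"

definition is_biproduct ::
  "('o, 'm, 'z) add_cat_scheme \<Rightarrow> 'o \<Rightarrow> 'o \<Rightarrow> 'o \<Rightarrow> 'm \<Rightarrow> 'm \<Rightarrow> 'm \<Rightarrow> 'm \<Rightarrow> bool" where
  "is_biproduct C X Y S i j p q \<longleftrightarrow>
     i \<in> Hom C X S \<and> j \<in> Hom C Y S \<and> p \<in> Hom C S X \<and> q \<in> Hom C S Y \<and>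
     p \<cdot>\<^bsub>C\<^esub> i = Ident C X \<and> q \<cdot>\<^bsub>C\<^esub> j = Ident C Y \<and>
     p \<cdot>\<^bsub>C\<^esub> j = Zero C Y X \<and> q \<cdot>\<^bsub>C\<^esub> i = Zero C X Y \<and>
     Add C (i \<cdot>\<^bsub>C\<^esub> p) (j \<cdot>\<^bsub>C\<^esub> q) = Ident C S"

locale additive_category = category C
  for C :: "('o, 'm, 'z) add_cat_scheme" (structure) +
  assumes hom_comm_group: "\<lbrakk>X \<in> Obj C; Y \<in> Obj C\<rbrakk> \<Longrightarrow> comm_group (hom_group C X Y)"
    and Comp_Add: "\<lbrakk>f \<in> Hom C X Y; f' \<in> Hom C X Y; g \<in> Hom C Y Z\<rbrakk> \<Longrightarrow> g \<cdot> (f \<boxplus> f') = g \<cdot> f \<boxplus> g \<cdot> f'"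
    and Add_Comp: "\<lbrakk>f \<in> Hom C X Y; g \<in> Hom C Y Z; g' \<in> Hom C Y Z\<rbrakk> \<Longrightarrow> (g \<boxplus> g') \<cdot> f = g \<cdot> f \<boxplus> g' \<cdot> f"
    and zero_object: "\<exists>N. is_zero_object C N"
    and biproducts: "\<lbrakk>X \<in> Obj C; Y \<in> Obj C\<rbrakk> \<Longrightarrow> \<exists>S i j p q. is_biproduct C X Y S i j p q"

text \<open>\<open>i : X \<rightarrow> Y\<close> is a kernel of \<open>p : Y \<rightarrow> Z\<close> and \<open>p\<close> is a cokernel of \<open>i\<close>.\<close>

definition kernel_cokernel_pair :: "('o, 'm, 'z) add_cat_scheme \<Rightarrow> 'm \<Rightarrow> 'm \<Rightarrow> bool" where
  "kernel_cokernel_pair C i p \<longleftrightarrow>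
     (\<exists>X Y Z. i \<in> Hom C X Y \<and> p \<in> Hom C Y Z \<and> p \<cdot>\<^bsub>C\<^esub> i = Zero C X Z \<and>
        (\<forall>W \<in> Obj C. \<forall>f \<in> Hom C W Y. p \<cdot>\<^bsub>C\<^esub> f = Zero C W Z \<longrightarrow>
           (\<exists>!g. g \<in> Hom C W X \<and> i \<cdot>\<^bsub>C\<^esub> g = f)) \<and>
        (\<forall>W \<in> Obj C. \<forall>f \<in> Hom C Y W. f \<cdot>\<^bsub>C\<^esub> i = Zero C X W \<longrightarrow>
           (\<exists>!g. g \<in> Hom C Z W \<and> g \<cdot>\<^bsub>C\<^esub> p = f)))"


section \<open>Exact categories\<close>

record ('o, 'm) exact_cat = "('o, 'm) add_cat" +
  Confl :: "('m \<times> 'm) set"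

definition conflation :: "('o, 'm, 'z) exact_cat_scheme \<Rightarrow> 'o \<Rightarrow> 'm \<Rightarrow> 'o \<Rightarrow> 'm \<Rightarrow> 'o \<Rightarrow> bool" where
  "conflation E X i Y p Z \<longleftrightarrow> i \<in> Hom E X Y \<and> p \<in> Hom E Y Z \<and> (i, p) \<in> Confl E"

definition inflation :: "('o, 'm, 'z) exact_cat_scheme \<Rightarrow> 'm \<Rightarrow> bool" where
  "inflation E i \<longleftrightarrow> (\<exists>p. (i, p) \<in> Confl E)"

definition deflation :: "('o, 'm, 'z) exact_cat_scheme \<Rightarrow> 'm \<Rightarrow> bool" where
  "deflation E p \<longleftrightarrow> (\<exists>i. (i, p) \<in> Confl E)"

text \<open>Quillen's axioms, in the reduced form of Keller and Buehler.\<close>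

locale exact_category = additive_category E
  for E :: "('o, 'm, 'z) exact_cat_scheme" (structure) +
  assumes Confl_kernel_cokernel: "(i, p) \<in> Confl E \<Longrightarrow> kernel_cokernel_pair E i p"
    and Confl_iso:
      "\<lbrakk>conflation E X i Y p Z; i' \<in> Hom E X' Y'; p' \<in> Hom E Y' Z';
        is_iso E X X' a; is_iso E Y Y' b; is_iso E Z Z' c;
        b \<cdot> i = i' \<cdot> a; c \<cdot> p = p' \<cdot> b\<rbrakk> \<Longrightarrow> conflation E X' i' Y' p' Z'"
    and inflation_Ident: "X \<in> Obj E \<Longrightarrow> inflation E (Ident E X)"
    and deflation_Ident: "X \<in> Obj E \<Longrightarrow> deflation E (Ident E X)"
    and inflation_Comp:
      "\<lbrakk>i \<in> Hom E X Y; j \<in> Hom E Y Z; inflation E i; inflation E j\<rbrakk> \<Longrightarrow> inflation E (j \<cdot> i)"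
    and deflation_Comp:
      "\<lbrakk>p \<in> Hom E X Y; q \<in> Hom E Y Z; deflation E p; deflation E q\<rbrakk> \<Longrightarrow> deflation E (q \<cdot> p)"
    and inflation_pushout:
      "\<lbrakk>i \<in> Hom E A B; inflation E i; f \<in> Hom E A A'\<rbrakk> \<Longrightarrow>
        \<exists>i' f'. is_pushout E i f i' f' \<and> inflation E i'"
    and deflation_pullback:
      "\<lbrakk>p \<in> Hom E B A; deflation E p; f \<in> Hom E A' A\<rbrakk> \<Longrightarrow>
        \<exists>p' f'. is_pullback E p f p' f' \<and> deflation E p'"

definition projective :: "('o, 'm, 'z) exact_cat_scheme \<Rightarrow> 'o \<Rightarrow> bool" where
  "projective E P \<longleftrightarrow> P \<in> Obj E \<and>
     (\<forall>Y Z. \<forall>p \<in> Hom E Y Z. deflation E p \<longrightarrow>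
       (\<forall>f \<in> Hom E P Z. \<exists>g \<in> Hom E P Y. p \<cdot>\<^bsub>E\<^esub> g = f))"

definition enough_projectives :: "('o, 'm, 'z) exact_cat_scheme \<Rightarrow> bool" where
  "enough_projectives E \<longleftrightarrow>
     (\<forall>X \<in> Obj E. \<exists>P. projective E P \<and> (\<exists>p \<in> Hom E P X. deflation E p))"

text \<open>A choice of a conflation \<open>0 \<rightarrow> \<Omega> X \<rightarrow> P X \<rightarrow> X \<rightarrow> 0\<close> with \<open>P X\<close> projective for every object \<open>X\<close>.\<close>

definition syzygy_choice ::
  "('o, 'm, 'z) exact_cat_scheme \<Rightarrow> ('o \<Rightarrow> 'o) \<Rightarrow> ('o \<Rightarrow> 'm) \<Rightarrow> ('o \<Rightarrow> 'o) \<Rightarrow> ('o \<Rightarrow> 'm) \<Rightarrow> bool" where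
  "syzygy_choice E \<Omega> \<iota> P \<pi> \<longleftrightarrow>
     (\<forall>X \<in> Obj E. projective E (P X) \<and> conflation E (\<Omega> X) (\<iota> X) (P X) (\<pi> X) X)"


section \<open>The stable category\<close>

definition factors_projective :: "('o, 'm, 'z) exact_cat_scheme \<Rightarrow> 'o \<Rightarrow> 'o \<Rightarrow> 'm \<Rightarrow> bool" where
  "factors_projective E X Y h \<longleftrightarrow>
     (\<exists>P. projective E P \<and> (\<exists>a \<in> Hom E X P. \<exists>b \<in> Hom E P Y. h = b \<cdot>\<^bsub>E\<^esub> a))"

definition stable_rel :: "('o, 'm, 'z) exact_cat_scheme \<Rightarrow> ('m \<times> 'm) set" where
  "stable_rel E =
     {(f, g). \<exists>X Y. f \<in> Hom E X Y \<and> g \<in> Hom E X Y \<and>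
        (\<exists>h. factors_projective E X Y h \<and> f = Add E g h)}"

text \<open>
  Morphisms are the classes of \<^const>\<open>stable_rel\<close>. The union in the definition of composition runs
  over representatives and consists of a single class, by the lemma \<open>stable_Comp\<close> below.
\<close>

definition stable_category :: "('o, 'm, 'z) exact_cat_scheme \<Rightarrow> ('o, 'm set) cat" where
  "stable_category E = \<lparr>
     Obj = Obj E,
     Hom = (\<lambda>X Y. Hom E X Y // stable_rel E),
     Comp = (\<lambda>V U. \<Union>v\<in>V. \<Union>u\<in>U. stable_rel E `` {v \<cdot>\<^bsub>E\<^esub> u}),
     Ident = (\<lambda>X. stable_rel E `` {Ident E X})\<rparr>"

context additive_category
begin

lemma Zero_closed: "X \<in> Obj C \<Longrightarrow> Y \<in> Obj C \<Longrightarrow> Zero C X Y \<in> Hom C X Y"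
  using comm_groupE(2)[OF hom_comm_group] by (simp add: hom_group_def)

lemma Add_closed: "f \<in> Hom C X Y \<Longrightarrow> g \<in> Hom C X Y \<Longrightarrow> f \<boxplus> g \<in> Hom C X Y"
  using comm_groupE(1)[OF hom_comm_group, of X Y f g] Hom_obj[of f X Y]
  by (simp add: hom_group_def)

lemma Add_assoc:
  "f \<in> Hom C X Y \<Longrightarrow> g \<in> Hom C X Y \<Longrightarrow> h \<in> Hom C X Y \<Longrightarrow> f \<boxplus> g \<boxplus> h = f \<boxplus> (g \<boxplus> h)"
  using comm_groupE(3)[OF hom_comm_group, of X Y f g h] Hom_obj[of f X Y]
  by (simp add: hom_group_def)

lemma Add_commute: "f \<in> Hom C X Y \<Longrightarrow> g \<in> Hom C X Y \<Longrightarrow> f \<boxplus> g = g \<boxplus> f"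
  using comm_groupE(4)[OF hom_comm_group, of X Y f g] Hom_obj[of f X Y]
  by (simp add: hom_group_def)

lemma Zero_Add: "f \<in> Hom C X Y \<Longrightarrow> Zero C X Y \<boxplus> f = f"
  using comm_groupE(5)[OF hom_comm_group, of X Y f] Hom_obj[of f X Y]
  by (simp add: hom_group_def)

lemma Add_inverse: "f \<in> Hom C X Y \<Longrightarrow> \<exists>g \<in> Hom C X Y. g \<boxplus> f = Zero C X Y"
  using comm_groupE(6)[OF hom_comm_group, of X Y f] Hom_obj[of f X Y]
  by (simp add: hom_group_def)

lemma Add_idem: 
  assumes "f \<in> Hom C X Y" "f \<boxplus> f = f" shows "f = Zero C X Y"
proof -
  obtain g where g: "g \<in> Hom C X Y" "g \<boxplus> f = Zero C X Y" using Add_inverse assms(1) by blast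
  have "f = g \<boxplus> f \<boxplus> f" using Zero_Add[OF assms(1)] g(2) by simp
  also have "\<dots> = g \<boxplus> f" using Add_assoc[OF g(1) assms(1) assms(1)] assms(2) by simp
  finally show ?thesis using g(2) by simp
qed

lemma Comp_Zero:
  assumes "X \<in> Obj C" "g \<in> Hom C Y Z" shows "g \<cdot> Zero C X Y = Zero C X Z"
proof -
  have z: "Zero C X Y \<in> Hom C X Y" using Zero_closed assms Hom_obj by blast
  show ?thesis
    using Add_idem[OF Comp_closed[OF z assms(2)]] Comp_Add[OF z z assms(2)] Zero_Add[OF z] by simp
qed

lemma Zero_Comp:
  assumes "Z \<in> Obj C" "f \<in> Hom C X Y" shows "Zero C Y Z \<cdot> f = Zero C X Z"
proof -
  have z: "Zero C Y Z \<in> Hom C Y Z" using Zero_closed assms Hom_obj by blast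
  show ?thesis
    using Add_idem[OF Comp_closed[OF assms(2) z]] Add_Comp[OF assms(2) z z] Zero_Add[OF z] by simp
qed

end

context exact_category
begin

lemma factors_projective_Hom: "factors_projective E X Y h \<Longrightarrow> h \<in> Hom E X Y"
  unfolding factors_projective_def by (auto intro: Comp_closed)

lemma factors_projective_Comp:
  assumes "factors_projective E X Y h" "g \<in> Hom E Y Z"
  shows "factors_projective E X Z (g \<cdot> h)"
proof -
  obtain P a b where P: "projective E P" "a \<in> Hom E X P" "b \<in> Hom E P Y" "h = b \<cdot> a"
    using assms(1) unfolding factors_projective_def by blast
  have "g \<cdot> h = (g \<cdot> b) \<cdot> a" using Comp_assoc[OF P(2,3) assms(2)] P(4) by simp
  then show ?thesis unfolding factors_projective_def using P Comp_closed[OF P(3) assms(2)] by blast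
qed

lemma Comp_factors_projective:
  assumes "factors_projective E Y Z h" "f \<in> Hom E X Y"
  shows "factors_projective E X Z (h \<cdot> f)"
proof -
  obtain P a b where P: "projective E P" "a \<in> Hom E Y P" "b \<in> Hom E P Z" "h = b \<cdot> a"
    using assms(1) unfolding factors_projective_def by blast
  have "h \<cdot> f = b \<cdot> (a \<cdot> f)" using Comp_assoc[OF assms(2) P(2,3)] P(4) by simp
  then show ?thesis unfolding factors_projective_def using P Comp_closed[OF assms(2) P(2)] by blast
qed

lemma projective_biproduct:
  assumes "projective E P" "projective E Q" "is_biproduct E P Q S i j p q"
  shows "projective E S"
  unfolding projective_def
proof (intro conjI allI ballI impI)
  have b: "i \<in> Hom E P S" "j \<in> Hom E Q S" "p \<in> Hom E S P" "q \<in> Hom E S Q"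
    "i \<cdot> p \<boxplus> j \<cdot> q = Ident E S"
    using assms(3) unfolding is_biproduct_def by blast+
  show "S \<in> Obj E" using b Hom_obj by blast
  fix Y Z r f assume r: "r \<in> Hom E Y Z" "deflation E r" and f: "f \<in> Hom E S Z"
  obtain u where u: "u \<in> Hom E P Y" "r \<cdot> u = f \<cdot> i"
    using assms(1) r Comp_closed[OF b(1) f] unfolding projective_def by blast
  obtain v where v: "v \<in> Hom E Q Y" "r \<cdot> v = f \<cdot> j"
    using assms(2) r Comp_closed[OF b(2) f] unfolding projective_def by blast
  have m: "u \<cdot> p \<in> Hom E S Y" "v \<cdot> q \<in> Hom E S Y" "i \<cdot> p \<in> Hom E S S" "j \<cdot> q \<in> Hom E S S"
    using b u v Comp_closed by blast+
  have "r \<cdot> (u \<cdot> p \<boxplus> v \<cdot> q) = r \<cdot> (u \<cdot> p) \<boxplus> r \<cdot> (v \<cdot> q)" by (rule Comp_Add[OF m(1,2) r(1)])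
  also have "\<dots> = f \<cdot> (i \<cdot> p) \<boxplus> f \<cdot> (j \<cdot> q)"
    using Comp_assoc[OF b(3) u(1) r(1)] Comp_assoc[OF b(4) v(1) r(1)]
      Comp_assoc[OF b(3) b(1) f] Comp_assoc[OF b(4) b(2) f] u v by simp
  also have "\<dots> = f" using Comp_Add[OF m(3,4) f] b(5) Comp_Ident[OF f] by simp
  finally show "\<exists>g \<in> Hom E S Y. r \<cdot> g = f" using Add_closed[OF m(1,2)] by blast
qed

lemma factors_projective_Add:
  assumes "factors_projective E X Y h" "factors_projective E X Y h'"
  shows "factors_projective E X Y (h \<boxplus> h')"
proof -
  obtain P a b where P: "projective E P" "a \<in> Hom E X P" "b \<in> Hom E P Y" "h = b \<cdot> a"
    using assms(1) unfolding factors_projective_def by blast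
  obtain Q c d where Q: "projective E Q" "c \<in> Hom E X Q" "d \<in> Hom E Q Y" "h' = d \<cdot> c"
    using assms(2) unfolding factors_projective_def by blast
  obtain S i j p q where S: "is_biproduct E P Q S i j p q"
    using biproducts P Q unfolding projective_def by meson
  have s: "i \<in> Hom E P S" "j \<in> Hom E Q S" "p \<in> Hom E S P" "q \<in> Hom E S Q"
    "p \<cdot> i = Ident E P" "q \<cdot> j = Ident E Q" "p \<cdot> j = Zero E Q P" "q \<cdot> i = Zero E P Q"
    using S unfolding is_biproduct_def by blast+
  have PQ: "P \<in> Obj E" "Q \<in> Obj E" using P Q unfolding projective_def by auto
  have ia: "i \<cdot> a \<in> Hom E X S" "j \<cdot> c \<in> Hom E X S" using P Q s Comp_closed by blast+
  have z: "Zero E X Q \<in> Hom E X Q" "Zero E X P \<in> Hom E X P"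
    using Zero_closed PQ P(2) Q(2) Hom_obj by blast+
  let ?x = "i \<cdot> a \<boxplus> j \<cdot> c" and ?y = "b \<cdot> p \<boxplus> d \<cdot> q"
  have x: "?x \<in> Hom E X S" by (rule Add_closed[OF ia])
  have bp: "b \<cdot> p \<in> Hom E S Y" "d \<cdot> q \<in> Hom E S Y" using P Q s Comp_closed by blast+
  have y: "?y \<in> Hom E S Y" by (rule Add_closed[OF bp])
  have "p \<cdot> ?x = a"
  proof -
    have "p \<cdot> ?x = p \<cdot> (i \<cdot> a) \<boxplus> p \<cdot> (j \<cdot> c)" by (rule Comp_Add[OF ia s(3)])
    also have "\<dots> = a \<boxplus> Zero E X P"
      using Comp_assoc[OF P(2) s(1,3)] Comp_assoc[OF Q(2) s(2,3)] s(5,7)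
        Ident_Comp[OF P(2)] Zero_Comp[OF PQ(1) Q(2)] by simp
    also have "\<dots> = a" using Add_commute[OF P(2) z(2)] Zero_Add[OF P(2)] by simp
    finally show ?thesis .
  qed
  moreover have "q \<cdot> ?x = c"
  proof -
    have "q \<cdot> ?x = q \<cdot> (i \<cdot> a) \<boxplus> q \<cdot> (j \<cdot> c)" by (rule Comp_Add[OF ia s(4)])
    also have "\<dots> = Zero E X Q \<boxplus> c"
      using Comp_assoc[OF P(2) s(1,4)] Comp_assoc[OF Q(2) s(2,4)] s(6,8)
        Ident_Comp[OF Q(2)] Zero_Comp[OF PQ(2) P(2)] by simp
    also have "\<dots> = c" using Zero_Add[OF Q(2)] by simp
    finally show ?thesis .
  qed
  moreover have "?y \<cdot> ?x = b \<cdot> (p \<cdot> ?x) \<boxplus> d \<cdot> (q \<cdot> ?x)"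
    using Add_Comp[OF x bp] Comp_assoc[OF x s(3) P(3)] Comp_assoc[OF x s(4) Q(3)] by simp
  ultimately have "h \<boxplus> h' = ?y \<cdot> ?x" using P(4) Q(4) by simp
  then show ?thesis
    unfolding factors_projective_def using projective_biproduct[OF P(1) Q(1) S] x y by blast
qed

lemma factors_projective_Zero:
  assumes "X \<in> Obj E" "Y \<in> Obj E"
  shows "factors_projective E X Y (Zero E X Y)"
proof -
  obtain N where N: "is_zero_object E N" using zero_object by blast
  then have o: "N \<in> Obj E" unfolding is_zero_object_def by blast
  have "projective E N"
    unfolding projective_def
  proof (intro conjI o allI ballI impI)
    fix Y Z p f assume p: "p \<in> Hom E Y Z" and f: "f \<in> Hom E N Z"
    have Y: "Y \<in> Obj E" "Z \<in> Obj E" using Hom_obj p by auto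
    have "p \<cdot> Zero E N Y = f"
      using N Y(2) f Comp_closed[OF Zero_closed[OF o Y(1)] p] unfolding is_zero_object_def by blast
    then show "\<exists>g \<in> Hom E N Y. p \<cdot> g = f" using Zero_closed[OF o Y(1)] by blast
  qed
  moreover have "Zero E X Y = Zero E N Y \<cdot> Zero E X N"
    using Comp_Zero[OF assms(1) Zero_closed[OF o assms(2)]] by simp
  ultimately show ?thesis
    unfolding factors_projective_def using Zero_closed assms o by blast
qed

lemma factors_projective_inverse:
  assumes "factors_projective E X Y h"
  shows "\<exists>h'. factors_projective E X Y h' \<and> h \<boxplus> h' = Zero E X Y"
proof -
  have h: "h \<in> Hom E X Y" by (rule factors_projective_Hom[OF assms])
  then have Y: "Y \<in> Obj E" using Hom_obj by blast
  obtain n where n: "n \<in> Hom E Y Y" "n \<boxplus> Ident E Y = Zero E Y Y"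
    using Add_inverse[OF Ident_closed[OF Y]] by blast
  have "n \<cdot> h \<boxplus> h = Zero E X Y"
    using Add_Comp[OF h n(1) Ident_closed[OF Y]] Ident_Comp[OF h] n(2) Zero_Comp[OF Y h] by simp
  then have "h \<boxplus> n \<cdot> h = Zero E X Y" using Add_commute[OF h Comp_closed[OF h n(1)]] by simp
  then show ?thesis using factors_projective_Comp[OF assms n(1)] by blast
qed

lemma stable_relI:
  "\<lbrakk>g \<in> Hom E X Y; factors_projective E X Y h; f = g \<boxplus> h\<rbrakk> \<Longrightarrow> (f, g) \<in> stable_rel E"
  unfolding stable_rel_def using Add_closed factors_projective_Hom by blast

lemma stable_relE:
  assumes "(f, g) \<in> stable_rel E" "f \<in> Hom E X Y \<or> g \<in> Hom E X Y"
  obtains h where "f \<in> Hom E X Y" "g \<in> Hom E X Y" "factors_projective E X Y h" "f = g \<boxplus> h"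
  using assms Hom_disjoint unfolding stable_rel_def by (smt (verit) case_prodD mem_Collect_eq)

lemma equiv_stable_rel: "equiv (\<Union>X. \<Union>Y. Hom E X Y) (stable_rel E)"
proof (rule equivI)
  show "stable_rel E \<subseteq> (\<Union>X. \<Union>Y. Hom E X Y) \<times> (\<Union>X. \<Union>Y. Hom E X Y)"
    unfolding stable_rel_def by blast
  show "refl_on (\<Union>X. \<Union>Y. Hom E X Y) (stable_rel E)"
  proof (rule refl_onI)
    fix f assume "f \<in> (\<Union>X. \<Union>Y. Hom E X Y)"
    then obtain X Y where f: "f \<in> Hom E X Y" by blast
    have o: "X \<in> Obj E" "Y \<in> Obj E" using f Hom_obj by auto
    show "(f, f) \<in> stable_rel E"
      using stable_relI[OF f factors_projective_Zero[OF o]] Zero_Add[OF f]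
        Add_commute[OF f Zero_closed[OF o]] by simp
  qed
  show "sym (stable_rel E)"
  proof (rule symI)
    fix f g assume "(f, g) \<in> stable_rel E"
    then obtain X Y h where h: "f \<in> Hom E X Y" "g \<in> Hom E X Y" "factors_projective E X Y h" "f = g \<boxplus> h"
      unfolding stable_rel_def by blast
    obtain h' where h': "factors_projective E X Y h'" "h \<boxplus> h' = Zero E X Y"
      using factors_projective_inverse[OF h(3)] by blast
    have o: "X \<in> Obj E" "Y \<in> Obj E" using h(1) Hom_obj by auto
    have "f \<boxplus> h' = g"
      using Add_assoc[OF h(2) factors_projective_Hom[OF h(3)] factors_projective_Hom[OF h'(1)]]
        h(4) h'(2) Add_commute[OF h(2) Zero_closed[OF o]] Zero_Add[OF h(2)] by simp
    then show "(g, f) \<in> stable_rel E" using stable_relI[OF h(1) h'(1)] by simp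
  qed
  show "trans (stable_rel E)"
  proof (rule transI)
    fix e f g assume ef: "(e, f) \<in> stable_rel E" and "(f, g) \<in> stable_rel E"
    then obtain X Y h where h: "f \<in> Hom E X Y" "g \<in> Hom E X Y" "factors_projective E X Y h" "f = g \<boxplus> h"
      unfolding stable_rel_def by blast
    obtain h' where h': "factors_projective E X Y h'" "e = f \<boxplus> h'"
      using stable_relE[OF ef] h(1) by metis
    have "e = g \<boxplus> (h \<boxplus> h')"
      using Add_assoc[OF h(2) factors_projective_Hom[OF h(3)] factors_projective_Hom[OF h'(1)]]
        h(4) h'(2) by simp
    then show "(e, g) \<in> stable_rel E"
      using stable_relI[OF h(2) factors_projective_Add[OF h(3) h'(1)]] by blast
  qed
qed

lemma stable_rel_Comp:
  assumes "(v, v') \<in> stable_rel E" "(u, u') \<in> stable_rel E" "u \<in> Hom E X Y" "v \<in> Hom E Y Z"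
  shows "(v \<cdot> u, v' \<cdot> u') \<in> stable_rel E"
proof -
  obtain h where h: "v' \<in> Hom E Y Z" "factors_projective E Y Z h" "v = v' \<boxplus> h"
    using stable_relE[OF assms(1)] assms(4) by metis
  obtain g where g: "u' \<in> Hom E X Y" "factors_projective E X Y g" "u = u' \<boxplus> g"
    using stable_relE[OF assms(2)] assms(3) by metis
  note hH = factors_projective_Hom[OF h(2)] and gH = factors_projective_Hom[OF g(2)]
  have "v \<cdot> u = v' \<cdot> u \<boxplus> h \<cdot> u" using Add_Comp[OF assms(3) h(1) hH] h(3) by simp
  also have "\<dots> = v' \<cdot> u' \<boxplus> v' \<cdot> g \<boxplus> h \<cdot> u" using Comp_Add[OF g(1) gH h(1)] g(3) by simp
  also have "\<dots> = v' \<cdot> u' \<boxplus> (v' \<cdot> g \<boxplus> h \<cdot> u)"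
    by (rule Add_assoc[OF Comp_closed[OF g(1) h(1)] Comp_closed[OF gH h(1)] Comp_closed[OF assms(3) hH]])
  finally show ?thesis
    using stable_relI[OF Comp_closed[OF g(1) h(1)] factors_projective_Add[OF
          factors_projective_Comp[OF g(2) h(1)] Comp_factors_projective[OF h(2) assms(3)]]] by blast
qed

lemma stable_Comp:
  assumes u: "u \<in> Hom E X Y" and v: "v \<in> Hom E Y Z"
  shows "Comp (stable_category E) (stable_rel E `` {v}) (stable_rel E `` {u}) = stable_rel E `` {v \<cdot> u}"
proof -
  have r: "(u, u) \<in> stable_rel E" "(v, v) \<in> stable_rel E"
    using equiv_stable_rel u v unfolding equiv_def refl_on_def by blast+
  have "stable_rel E `` {v' \<cdot> u'} = stable_rel E `` {v \<cdot> u}"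
    if "(v, v') \<in> stable_rel E" "(u, u') \<in> stable_rel E" for u' v'
    using equiv_class_eq[OF equiv_stable_rel stable_rel_Comp[OF that u v]] by simp
  note eq = this
  have "(\<Union>v' \<in> stable_rel E `` {v}. \<Union>u' \<in> stable_rel E `` {u}. stable_rel E `` {v' \<cdot> u'})
    = stable_rel E `` {v \<cdot> u}" (is "?L = ?R")
  proof
    show "?L \<subseteq> ?R" by (intro UN_least equalityD1 eq) (auto elim: ImageE)
    show "?R \<subseteq> ?L" using r by blast
  qed
  then show ?thesis unfolding stable_category_def by simp
qed

lemma category_stable_category: "category (stable_category E)"
proof
  let ?S = "stable_category E"
  have H: "Hom ?S X Y = {stable_rel E `` {f} | f. f \<in> Hom E X Y}" for X Y
    unfolding stable_category_def quotient_def by auto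
  have I: "Ident ?S X = stable_rel E `` {Ident E X}" and O: "Obj ?S = Obj E" for X
    unfolding stable_category_def by auto
  show "X \<in> Obj ?S \<and> Y \<in> Obj ?S" if "f \<in> Hom ?S X Y" for f X Y
    using that Hom_obj unfolding H O by blast
  show "X = X' \<and> Y = Y'" if f: "f \<in> Hom ?S X Y" "f \<in> Hom ?S X' Y'" for f X Y X' Y'
  proof -
    obtain a where a: "a \<in> Hom E X Y" "f = stable_rel E `` {a}"
      using f(1) unfolding H by blast
    obtain b where b: "b \<in> Hom E X' Y'" "f = stable_rel E `` {b}"
      using f(2) unfolding H by blast
    have "b \<in> (\<Union>X. \<Union>Y. Hom E X Y)" using b(1) by blast
    then have "(a, b) \<in> stable_rel E"
      using eq_equiv_class[OF _ equiv_stable_rel, of a b] a(2) b(2) by simp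
    then show ?thesis using stable_relE[of a b X Y] a(1) b(1) Hom_disjoint by metis
  qed
  show "Comp ?S g f \<in> Hom ?S X Z" if "f \<in> Hom ?S X Y" "g \<in> Hom ?S Y Z" for f g X Y Z
    using that stable_Comp Comp_closed unfolding H by fastforce
  show "Ident ?S X \<in> Hom ?S X X" if "X \<in> Obj ?S" for X
    using that Ident_closed unfolding H I O by blast
  show "Comp ?S (Comp ?S h g) f = Comp ?S h (Comp ?S g f)"
    if fgh: "f \<in> Hom ?S W X" "g \<in> Hom ?S X Y" "h \<in> Hom ?S Y Z" for f g h W X Y Z
  proof -
    obtain a b c where a: "a \<in> Hom E W X" "f = stable_rel E `` {a}"
      and b: "b \<in> Hom E X Y" "g = stable_rel E `` {b}"
      and c: "c \<in> Hom E Y Z" "h = stable_rel E `` {c}"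
      using fgh unfolding H by auto
    show ?thesis
      using stable_Comp[OF a(1) b(1)] stable_Comp[OF b(1) c(1)]
        stable_Comp[OF a(1) Comp_closed[OF b(1) c(1)]] stable_Comp[OF Comp_closed[OF a(1) b(1)] c(1)]
        Comp_assoc[OF a(1) b(1) c(1)] a(2) b(2) c(2) by simp
  qed
  show "Comp ?S f (Ident ?S X) = f" "Comp ?S (Ident ?S Y) f = f" if f: "f \<in> Hom ?S X Y" for f X Y
  proof -
    obtain a where a: "a \<in> Hom E X Y" "f = stable_rel E `` {a}" using f unfolding H by auto
    have o: "X \<in> Obj E" "Y \<in> Obj E" using a Hom_obj by auto
    show "Comp ?S f (Ident ?S X) = f"
      using stable_Comp[OF Ident_closed[OF o(1)] a(1)] Comp_Ident[OF a(1)] a(2) I by simp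
    show "Comp ?S (Ident ?S Y) f = f"
      using stable_Comp[OF a(1) Ident_closed[OF o(2)]] Ident_Comp[OF a(1)] a(2) I by simp
  qed
qed

end

definition stable_retract :: "('o, 'm, 'z) exact_cat_scheme \<Rightarrow> 'o \<Rightarrow> 'o \<Rightarrow> bool" where
  "stable_retract E X Y \<longleftrightarrow> retract (stable_category E) X Y"


section \<open>Delooping levels\<close>

definition dell :: "('o, 'm, 'z) exact_cat_scheme \<Rightarrow> ('o \<Rightarrow> 'o) \<Rightarrow> nat \<Rightarrow> 'o \<Rightarrow> enat" where
  "dell E \<Omega> k X =
     Inf {enat n | n. \<exists>Y \<in> Obj E. stable_retract E ((\<Omega> ^^ n) X) ((\<Omega> ^^ (n + k)) Y)}"

text \<open>
  \<open>admissibly_exact E t C d X\<close>: the sequence \<open>0 \<rightarrow> C t \<rightarrow> \<dots> \<rightarrow> C 0 \<rightarrow> X \<rightarrow> 0\<close> with maps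
  \<open>d 0 : C 0 \<rightarrow> X\<close> and \<open>d i : C i \<rightarrow> C (i - 1)\<close> for \<open>0 < i \<le> t\<close> is spliced from conflations
  \<open>0 \<rightarrow> Z (i + 1) \<rightarrow> C i \<rightarrow> Z i \<rightarrow> 0\<close> for \<open>i < t\<close>.
\<close>

definition admissibly_exact ::
  "('o, 'm, 'z) exact_cat_scheme \<Rightarrow> nat \<Rightarrow> (nat \<Rightarrow> 'o) \<Rightarrow> (nat \<Rightarrow> 'm) \<Rightarrow> 'o \<Rightarrow> bool" where
  "admissibly_exact E t C d X \<longleftrightarrow>
     (if t = 0 then is_iso E (C 0) X (d 0)
      else \<exists>Z j q. Z 0 = X \<and> Z t = C t \<and>
             (\<forall>i<t. conflation E (Z (i + 1)) (j i) (C i) (q i) (Z i)) \<and>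
             d 0 = q 0 \<and> (\<forall>i. 0 < i \<and> i < t \<longrightarrow> d i = j (i - 1) \<cdot>\<^bsub>E\<^esub> q i) \<and> d t = j (t - 1))"

definition ddell :: "('o, 'm, 'z) exact_cat_scheme \<Rightarrow> ('o \<Rightarrow> 'o) \<Rightarrow> nat \<Rightarrow> 'o \<Rightarrow> enat" where
  "ddell E \<Omega> k X =
     Inf {enat m | m. \<exists>t\<le>m. \<exists>C d. admissibly_exact E t C d X \<and>
                        (\<forall>i\<le>t. dell E \<Omega> (i + k) (C i) \<le> enat (m - i))}"

end

theory Submission
  imports Defs
begin

text \<open>
  The proof is by induction on \<open>m = ddell k X\<close>, for all \<open>k\<close> at once; put \<open>n = ddell k Z\<close>. Rotating
  \<open>X \<rightarrow> Y \<rightarrow> Z\<close> gives a conflation \<open>S \<rightarrow> X \<oplus> Q \<rightarrow> Y\<close> with \<open>Q\<close> projective and \<open>S\<close> a syzygy of \<open>Z\<close> that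
  satisfies \<open>ddell (k + 1) S \<le> n\<close>. If already \<open>dell k X \<le> m\<close>, then \<open>X \<oplus> Q\<close> followed by a resolution
  of \<open>S\<close> resolves \<open>Y\<close>. Otherwise there is a conflation \<open>K \<rightarrow> C \<rightarrow> X\<close> with \<open>dell k C \<le> m\<close> and
  \<open>ddell (k + 1) K \<le> m - 1\<close>; the kernel of the composite \<open>C \<oplus> Q \<rightarrow> X \<oplus> Q \<rightarrow> Y\<close> is an extension of \<open>S\<close>
  by \<open>K\<close>, to which the induction hypothesis applies.
\<close>

section \<open>Kernels, pullbacks and conflations\<close>

context additive_category
begin

lemma Add_Zero: "f \<in> Hom C X Y \<Longrightarrow> f \<boxplus> Zero C X Y = f"
  using Zero_Add Add_commute Zero_closed Hom_obj by metis

lemma Add_right_cancel: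
  assumes "f \<in> Hom C X Y" "g \<in> Hom C X Y" "h \<in> Hom C X Y" "f \<boxplus> h = g \<boxplus> h"
  shows "f = g"
proof -
  obtain n where n: "n \<in> Hom C X Y" "n \<boxplus> h = Zero C X Y" using Add_inverse[OF assms(3)] by blast
  have "h \<boxplus> n = Zero C X Y" using n Add_commute[OF assms(3) n(1)] by simp
  then have "f' \<boxplus> h \<boxplus> n = f'" if "f' \<in> Hom C X Y" for f'
    using Add_assoc[OF that assms(3) n(1)] Add_Zero[OF that] by simp
  then show ?thesis using assms by metis
qed

text \<open>Stands in for subtraction: later steps use only the defining equation of f - g.\<close>

lemma difference_exists:
  assumes "f \<in> Hom C X Y" "g \<in> Hom C X Y"
  shows "\<exists>d \<in> Hom C X Y. d \<boxplus> g = f"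
proof -
  obtain n where n: "n \<in> Hom C X Y" "n \<boxplus> g = Zero C X Y" using Add_inverse[OF assms(2)] by blast
  then have "f \<boxplus> n \<boxplus> g = f" using Add_assoc[OF assms(1) n(1) assms(2)] Add_Zero[OF assms(1)] by simp
  then show ?thesis using Add_closed[OF assms(1) n(1)] by blast
qed

end

text \<open>Unlike in \<open>is_pullback\<close>, the corners are arguments, so that the universal
  property applies without first identifying existentially bound objects through
  \<open>Hom_disjoint\<close>. Each primed map lies opposite its unprimed namesake.\<close>

definition pullback_square ::
  "('o, 'm, 'z) cat_scheme \<Rightarrow> 'o \<Rightarrow> 'o \<Rightarrow> 'o \<Rightarrow> 'o \<Rightarrow> 'm \<Rightarrow> 'm \<Rightarrow> 'm \<Rightarrow> 'm \<Rightarrow> bool" where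
  "pullback_square C B A B' A' p f p' f' \<longleftrightarrow>
     p \<in> Hom C B A \<and> f \<in> Hom C A' A \<and> p' \<in> Hom C B' A' \<and> f' \<in> Hom C B' B \<and>
     p \<cdot>\<^bsub>C\<^esub> f' = f \<cdot>\<^bsub>C\<^esub> p' \<and>
     (\<forall>W. \<forall>b \<in> Hom C W B. \<forall>a \<in> Hom C W A'. p \<cdot>\<^bsub>C\<^esub> b = f \<cdot>\<^bsub>C\<^esub> a \<longrightarrow>
       (\<exists>!h. h \<in> Hom C W B' \<and> f' \<cdot>\<^bsub>C\<^esub> h = b \<and> p' \<cdot>\<^bsub>C\<^esub> h = a))"

lemma pullback_squareD:
  assumes "pullback_square C B A B' A' p f p' f'"
  shows "p \<in> Hom C B A" "f \<in> Hom C A' A" "p' \<in> Hom C B' A'" "f' \<in> Hom C B' B"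
    "p \<cdot>\<^bsub>C\<^esub> f' = f \<cdot>\<^bsub>C\<^esub> p'"
  using assms unfolding pullback_square_def by blast+

lemma pullback_square_lift:
  assumes "pullback_square C B A B' A' p f p' f'"
    "b \<in> Hom C W B" "a \<in> Hom C W A'" "p \<cdot>\<^bsub>C\<^esub> b = f \<cdot>\<^bsub>C\<^esub> a"
  obtains h where "h \<in> Hom C W B'" "f' \<cdot>\<^bsub>C\<^esub> h = b" "p' \<cdot>\<^bsub>C\<^esub> h = a"
  using assms unfolding pullback_square_def by blast

lemma pullback_square_swap:
  "pullback_square C B A B' A' p f p' f' \<Longrightarrow> pullback_square C A' A B' B f p f' p'"
  unfolding pullback_square_def by (smt (verit))

context category
begin

text \<open>The two projections are jointly monic: both h and h' lift the compatible pair consisting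
  of \<open>f' \<cdot> h\<close> and \<open>p' \<cdot> h\<close>.\<close>

lemma pullback_square_unique:
  assumes "pullback_square C B A B' A' p f p' f'"
    "h \<in> Hom C W B'" "h' \<in> Hom C W B'" "f' \<cdot> h = f' \<cdot> h'" "p' \<cdot> h = p' \<cdot> h'"
  shows "h = h'"
proof -
  note D = pullback_squareD[OF assms(1)]
  have "p \<cdot> (f' \<cdot> h) = f \<cdot> (p' \<cdot> h)"
    using Comp_assoc[OF assms(2) D(4,1)] Comp_assoc[OF assms(2) D(3,2)] D(5) by simp
  then show ?thesis
    using assms Comp_closed[OF assms(2) D(4)] Comp_closed[OF assms(2) D(3)]
    unfolding pullback_square_def by metis
qed

lemma pullback_square_iso:
  assumes S: "pullback_square C B A B' A' p f p' f'" and T: "pullback_square C B A B'' A' p f p'' f''"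
  obtains h where "is_iso C B'' B' h" "f' \<cdot> h = f''" "p' \<cdot> h = p''"
proof -
  note D = pullback_squareD[OF S] and D' = pullback_squareD[OF T]
  obtain h where h: "h \<in> Hom C B'' B'" "f' \<cdot> h = f''" "p' \<cdot> h = p''"
    using pullback_square_lift[OF S D'(4,3,5)] by blast
  obtain g where g: "g \<in> Hom C B' B''" "f'' \<cdot> g = f'" "p'' \<cdot> g = p'"
    using pullback_square_lift[OF T D(4,3,5)] by blast
  have o: "B' \<in> Obj C" "B'' \<in> Obj C" using h Hom_obj by auto
  have "h \<cdot> g = Ident C B'"
    by (rule pullback_square_unique[OF S Comp_closed[OF g(1) h(1)] Ident_closed[OF o(1)]])
      (simp_all flip: Comp_assoc[OF g(1) h(1) D(4)] Comp_assoc[OF g(1) h(1) D(3)]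
        add: h g Comp_Ident[OF D(4)] Comp_Ident[OF D(3)])
  moreover have "g \<cdot> h = Ident C B''"
    by (rule pullback_square_unique[OF T Comp_closed[OF h(1) g(1)] Ident_closed[OF o(2)]])
      (simp_all flip: Comp_assoc[OF h(1) g(1) D'(4)] Comp_assoc[OF h(1) g(1) D'(3)]
        add: h g Comp_Ident[OF D'(4)] Comp_Ident[OF D'(3)])
  ultimately show thesis using that h g unfolding is_iso_def by blast
qed

lemma Ident_iso: "X \<in> Obj C \<Longrightarrow> is_iso C X X (Ident C X)"
  unfolding is_iso_def using Ident_closed Comp_Ident by blast

end

section \<open>Conflations as kernels of deflations\<close>

context exact_category
begin

lemma conflationD:
  assumes "conflation E X i Y p Z"
  shows "i \<in> Hom E X Y" "p \<in> Hom E Y Z" "(i, p) \<in> Confl E"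
    "X \<in> Obj E" "Y \<in> Obj E" "Z \<in> Obj E" "p \<cdot> i = Zero E X Z"
proof -
  show ip: "i \<in> Hom E X Y" "p \<in> Hom E Y Z" "(i, p) \<in> Confl E"
    using assms unfolding conflation_def by auto
  show "X \<in> Obj E" "Y \<in> Obj E" "Z \<in> Obj E" using ip Hom_obj by auto
  show "p \<cdot> i = Zero E X Z"
    using Confl_kernel_cokernel[OF ip(3)] ip(1,2) Hom_disjoint
    unfolding kernel_cokernel_pair_def by metis
qed

lemma conflation_kernel:
  assumes "conflation E X i Y p Z" "f \<in> Hom E W Y" "p \<cdot> f = Zero E W Z"
  shows "\<exists>!g. g \<in> Hom E W X \<and> i \<cdot> g = f"
proof -
  note D = conflationD[OF assms(1)]
  obtain X' Y' Z' where o: "i \<in> Hom E X' Y'" "p \<in> Hom E Y' Z'"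
    and u: "\<forall>W \<in> Obj E. \<forall>f \<in> Hom E W Y'. p \<cdot> f = Zero E W Z' \<longrightarrow> (\<exists>!g. g \<in> Hom E W X' \<and> i \<cdot> g = f)"
    using Confl_kernel_cokernel[OF D(3)] unfolding kernel_cokernel_pair_def by blast
  have "X' = X" "Y' = Y" "Z' = Z" using Hom_disjoint o D(1,2) by blast+
  then show ?thesis using u assms Hom_obj by blast
qed

lemma conflation_lift:
  assumes "conflation E X i Y p Z" "f \<in> Hom E W Y" "p \<cdot> f = Zero E W Z"
  obtains g where "g \<in> Hom E W X" "i \<cdot> g = f"
  using conflation_kernel[OF assms] by blast

text \<open>Uniqueness in the kernel property, applied to \<open>i \<cdot> g\<close>, which p
  kills.\<close>

lemma conflation_mono:
  assumes c: "conflation E X i Y p Z" and g: "g \<in> Hom E W X" "g' \<in> Hom E W X" "i \<cdot> g = i \<cdot> g'"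
  shows "g = g'"
proof -
  note D = conflationD[OF c]
  have "p \<cdot> (i \<cdot> g) = Zero E W Z"
    using Comp_assoc[OF g(1) D(1,2)] D(7) Zero_Comp[OF D(6) g(1)] by simp
  then show ?thesis using conflation_kernel[OF c Comp_closed[OF g(1) D(1)]] g by metis
qed

lemma deflation_conflation:
  assumes "p \<in> Hom E Y Z" "deflation E p"
  obtains X i where "conflation E X i Y p Z"
proof -
  obtain i where i: "(i, p) \<in> Confl E" using assms(2) unfolding deflation_def by blast
  then obtain X Y' where "i \<in> Hom E X Y'" "p \<in> Hom E Y' Z"
    using Confl_kernel_cokernel[OF i] assms(1) Hom_disjoint
    unfolding kernel_cokernel_pair_def by metis
  then have "conflation E X i Y p Z"
    unfolding conflation_def using i assms(1) Hom_disjoint by metis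
  then show thesis by (rule that)
qed

lemma conflation_deflation: "conflation E X i Y p Z \<Longrightarrow> deflation E p"
  unfolding conflation_def deflation_def by blast

text \<open>The deflation p sits in some conflation with kernel k. Two kernels of p are isomorphic
  over Y, and \<open>Confl\<close> is closed under isomorphism, so any kernel of p may replace
  k.\<close>

lemma conflation_of_kernel:
  assumes p: "p \<in> Hom E Y Z" "deflation E p" and i: "i \<in> Hom E X Y" "p \<cdot> i = Zero E X Z"
    and lift: "\<And>W f. f \<in> Hom E W Y \<Longrightarrow> p \<cdot> f = Zero E W Z \<Longrightarrow> \<exists>g \<in> Hom E W X. i \<cdot> g = f"
    and mono: "\<And>W g g'. g \<in> Hom E W X \<Longrightarrow> g' \<in> Hom E W X \<Longrightarrow> i \<cdot> g = i \<cdot> g' \<Longrightarrow> g = g'"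
  shows "conflation E X i Y p Z"
proof -
  obtain K k where k: "conflation E K k Y p Z" using deflation_conflation[OF p] by blast
  note D = conflationD[OF k]
  obtain a where a: "a \<in> Hom E K X" "i \<cdot> a = k" using lift[OF D(1,7)] by blast
  obtain a' where a': "a' \<in> Hom E X K" "k \<cdot> a' = i" using conflation_lift[OF k i] by blast
  have X: "X \<in> Obj E" using i Hom_obj by blast
  have "a \<cdot> a' = Ident E X"
    by (rule mono[OF Comp_closed[OF a'(1) a(1)] Ident_closed[OF X]])
      (simp flip: Comp_assoc[OF a'(1) a(1) i(1)] add: a a' Comp_Ident[OF i(1)])
  moreover have "a' \<cdot> a = Ident E K"
    by (rule conflation_mono[OF k Comp_closed[OF a(1) a'(1)] Ident_closed[OF D(4)]])
      (simp flip: Comp_assoc[OF a(1) a'(1) D(1)] add: a a' Comp_Ident[OF D(1)])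
  ultimately have "is_iso E K X a" unfolding is_iso_def using a a' by blast
  then show ?thesis
    by (rule Confl_iso[OF k i(1) p(1) _ Ident_iso[OF D(5)] Ident_iso[OF D(6)]])
      (simp_all add: a Ident_Comp[OF D(1)] Ident_Comp[OF D(2)] Comp_Ident[OF D(2)])
qed

lemma deflation_iso:
  assumes p: "p \<in> Hom E Y Z" "deflation E p" and h: "is_iso E Y Y' h"
    and p': "p' \<in> Hom E Y' Z" "p' \<cdot> h = p"
  shows "deflation E p'"
proof -
  obtain K k where k: "conflation E K k Y p Z" using deflation_conflation[OF p] by blast
  note D = conflationD[OF k]
  have hH: "h \<in> Hom E Y Y'" using h unfolding is_iso_def by blast
  have "conflation E K (h \<cdot> k) Y' p' Z"
    by (rule Confl_iso[OF k Comp_closed[OF D(1) hH] p'(1) Ident_iso[OF D(4)] h Ident_iso[OF D(6)]])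
      (simp_all add: Comp_Ident[OF Comp_closed[OF D(1) hH]] p' Ident_Comp[OF D(2)])
  then show ?thesis by (rule conflation_deflation)
qed

section \<open>Pullbacks and composites of conflations\<close>

lemma pullback_square_exists:
  assumes "p \<in> Hom E B A" "deflation E p" "f \<in> Hom E A' A"
  obtains B' p' f' where "pullback_square E B A B' A' p f p' f'" "deflation E p'"
proof -
  obtain p' f' where d: "is_pullback E p f p' f'" "deflation E p'"
    using deflation_pullback[OF assms] by blast
  obtain A0 B0 A0' B' where q: "p \<in> Hom E B0 A0" "f \<in> Hom E A0' A0" "p' \<in> Hom E B' A0'" "f' \<in> Hom E B' B0"
    "p \<cdot> f' = f \<cdot> p'"
    "\<forall>W \<in> Obj E. \<forall>b \<in> Hom E W B0. \<forall>a \<in> Hom E W A0'. p \<cdot> b = f \<cdot> a \<longrightarrow>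
           (\<exists>!h. h \<in> Hom E W B' \<and> f' \<cdot> h = b \<and> p' \<cdot> h = a)"
    using d(1) unfolding is_pullback_def by blast
  have "A0 = A" "B0 = B" "A0' = A'" using Hom_disjoint q assms by blast+
  then have "pullback_square E B A B' A' p f p' f'"
    unfolding pullback_square_def using q Hom_obj by blast
  then show thesis using d(2) that by blast
qed

text \<open>The axiom makes only some pullback of p a deflation; the isomorphism between two
  pullbacks carries this over to the given square. A pullback has the same kernel as the original
  map.\<close>

lemma pullback_conflation:
  assumes S: "pullback_square E B A B' A' p f p' f'" and c: "conflation E X i B p A"
  obtains i' where "conflation E X i' B' p' A'" "f' \<cdot> i' = i"
proof -
  note D = pullback_squareD[OF S] and K = conflationD[OF c]
  obtain B'' p'' f'' where T: "pullback_square E B A B'' A' p f p'' f''" "deflation E p''"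
    using pullback_square_exists[OF D(1) conflation_deflation[OF c] D(2)] by blast
  obtain h where h: "is_iso E B'' B' h" "f' \<cdot> h = f''" "p' \<cdot> h = p''"
    using pullback_square_iso[OF S T(1)] by blast
  have p': "deflation E p'" by (rule deflation_iso[OF pullback_squareD(3)[OF T(1)] T(2) h(1) D(3) h(3)])
  have o: "A' \<in> Obj E" "A \<in> Obj E" "B' \<in> Obj E" using D Hom_obj by auto
  \<comment> \<open>The inclusion of the kernel is the lift of the pair (i, 0).\<close>
  obtain i' where i': "i' \<in> Hom E X B'" "f' \<cdot> i' = i" "p' \<cdot> i' = Zero E X A'"
    using pullback_square_lift[OF S K(1) Zero_closed[OF K(4) o(1)]] K(7) Comp_Zero[OF K(4) D(2)]
    by metis
  have "conflation E X i' B' p' A'"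
  proof (rule conflation_of_kernel[OF D(3) p' i'(1,3)])
    fix W g assume g: "g \<in> Hom E W B'" "p' \<cdot> g = Zero E W A'"
    have W: "W \<in> Obj E" using g Hom_obj by blast
    have "p \<cdot> (f' \<cdot> g) = Zero E W A"
      using Comp_assoc[OF g(1) D(4,1)] Comp_assoc[OF g(1) D(3,2)] D(5) g(2) Comp_Zero[OF W D(2)] by simp
    then obtain u where u: "u \<in> Hom E W X" "i \<cdot> u = f' \<cdot> g"
      using conflation_lift[OF c Comp_closed[OF g(1) D(4)]] by blast
    have "i' \<cdot> u = g"
      by (rule pullback_square_unique[OF S Comp_closed[OF u(1) i'(1)] g(1)])
        (simp_all flip: Comp_assoc[OF u(1) i'(1) D(4)] Comp_assoc[OF u(1) i'(1) D(3)]
          add: i' u g Zero_Comp[OF o(1) u(1)])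
    then show "\<exists>u \<in> Hom E W X. i' \<cdot> u = g" using u by blast
  next
    fix W g g' assume g: "g \<in> Hom E W X" "g' \<in> Hom E W X" "i' \<cdot> g = i' \<cdot> g'"
    show "g = g'"
      by (rule conflation_mono[OF c g(1,2)])
        (metis g i'(1,2) Comp_assoc[OF _ i'(1) D(4)])
  qed
  then show thesis using i'(2) that by blast
qed

lemma conflation_pullback:
  assumes "conflation E X i B p A" "f \<in> Hom E A' A"
  obtains B' p' f' i' where "pullback_square E B A B' A' p f p' f'" "conflation E X i' B' p' A'"
proof -
  obtain B' p' f' where S: "pullback_square E B A B' A' p f p' f'"
    using pullback_square_exists conflationD[OF assms(1)] conflation_deflation[OF assms(1)] assms(2)
    by blast
  show thesis by (rule pullback_conflation[OF S assms(1)], rule that[OF S])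
qed

text \<open>W is the pullback of p and q. Reading the square in both directions makes both
  projections deflations, one with the kernel of p and the other with the kernel of q. With Q
  projective this is the rotation used below.\<close>

lemma conflation_bicartesian:
  assumes "conflation E X i Y p Z" "conflation E S j Q q Z"
  obtains W i' p' j' q' where "conflation E X i' W p' Q" "conflation E S j' W q' Y"
proof -
  obtain W p' q' i' where S: "pullback_square E Y Z W Q p q p' q'" and c: "conflation E X i' W p' Q"
    using conflation_pullback[OF assms(1) conflationD(2)[OF assms(2)]] by blast
  show thesis
    by (rule pullback_conflation[OF pullback_square_swap[OF S] assms(2)], rule that[OF c])
qed

text \<open>The kernel of the composite is the preimage of S under p, that is, the pullback of p
  along j. Hence its projection to S is a deflation with the same kernel as p.\<close>

lemma conflation_compose:
  assumes c: "conflation E K k B p A" and d: "conflation E S j A q Y"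
  obtains K' k' a b where "conflation E K' k' B (q \<cdot> p) Y" "conflation E K a K' b S"
proof -
  note C = conflationD[OF c] and D = conflationD[OF d]
  have qp: "q \<cdot> p \<in> Hom E B Y" "deflation E (q \<cdot> p)"
    using Comp_closed[OF C(2) D(2)] deflation_Comp[OF C(2) D(2)] c d conflation_deflation by blast+
  obtain K' k' where k': "conflation E K' k' B (q \<cdot> p) Y" using deflation_conflation[OF qp] by blast
  note F = conflationD[OF k']
  have "q \<cdot> (p \<cdot> k') = Zero E K' Y" using F(7) Comp_assoc[OF F(1) C(2) D(2)] by simp
  then obtain b where b: "b \<in> Hom E K' S" "j \<cdot> b = p \<cdot> k'"
    using conflation_lift[OF d Comp_closed[OF F(1) C(2)]] by blast
  have "pullback_square E B A K' S p j b k'"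
    unfolding pullback_square_def
  proof (intro conjI C D b F allI ballI impI)
    show "p \<cdot> k' = j \<cdot> b" using b by simp
    fix W x y assume x: "x \<in> Hom E W B" and y: "y \<in> Hom E W S" and xy: "p \<cdot> x = j \<cdot> y"
    \<comment> \<open>A compatible pair (x, y) has x killed by the composite, so x factors through
      k'; since j is monic, the second component is then y.\<close>
    have "q \<cdot> p \<cdot> x = Zero E W Y"
      using Comp_assoc[OF x C(2) D(2)] xy Comp_assoc[OF y D(1,2)] D(7) Zero_Comp[OF D(6) y] by simp
    then obtain h where h: "h \<in> Hom E W K'" "k' \<cdot> h = x" using conflation_lift[OF k' x] by blast
    have "b \<cdot> h = y"
      by (rule conflation_mono[OF d Comp_closed[OF h(1) b(1)] y])
        (simp flip: Comp_assoc[OF h(1) b(1) D(1)] xy add: b h Comp_assoc[OF h(1) F(1) C(2)])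
    then show "\<exists>!h. h \<in> Hom E W K' \<and> k' \<cdot> h = x \<and> b \<cdot> h = y"
      using h conflation_mono[OF k'] by metis
  qed
  then show thesis by (rule pullback_conflation[OF _ c], intro that[OF k'])
qed

end

section \<open>Stable retracts\<close>

lemma (in category) retract_trans:
  assumes "retract C X Y" "retract C Y Z"
  shows "retract C X Z"
proof -
  obtain u v where u: "u \<in> Hom C X Y" "v \<in> Hom C Y X" "v \<cdot> u = Ident C X"
    using assms(1) unfolding retract_def by blast
  obtain u' v' where u': "u' \<in> Hom C Y Z" "v' \<in> Hom C Z Y" "v' \<cdot> u' = Ident C Y"
    using assms(2) unfolding retract_def by blast
  have "(v \<cdot> v') \<cdot> (u' \<cdot> u) = v \<cdot> (v' \<cdot> u' \<cdot> u)"
    using Comp_assoc[OF Comp_closed[OF u(1) u'(1)] u'(2) u(2)] Comp_assoc[OF u(1) u'(1,2)] by simp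
  also have "\<dots> = Ident C X" using u' u Ident_Comp by simp
  finally show ?thesis
    using assms Comp_closed[OF u(1) u'(1)] Comp_closed[OF u'(2) u(2)] unfolding retract_def by blast
qed

lemma is_iso_retract:
  assumes "category C" "is_iso C X Y f"
  shows "retract C Y X"
  using assms category.Hom_obj unfolding is_iso_def retract_def by metis

context exact_category
begin

text \<open>Passes from classes to representatives, so that stable retracts can be handled by
  equations in E itself.\<close>

lemma stable_retract_iff:
  "stable_retract E X Y \<longleftrightarrow> X \<in> Obj E \<and> Y \<in> Obj E \<and>
     (\<exists>u \<in> Hom E X Y. \<exists>v \<in> Hom E Y X. \<exists>h. factors_projective E X X h \<and> Ident E X = v \<cdot> u \<boxplus> h)"
proof -
  have H: "Hom (stable_category E) X Y = (\<lambda>u. stable_rel E `` {u}) ` Hom E X Y" for X Y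
    unfolding stable_category_def quotient_def by auto
  have *: "stable_rel E `` {v \<cdot> u} = stable_rel E `` {Ident E X} \<longleftrightarrow>
      (\<exists>h. factors_projective E X X h \<and> Ident E X = v \<cdot> u \<boxplus> h)"
    if "X \<in> Obj E" "u \<in> Hom E X Y" "v \<in> Hom E Y X" for u v
  proof -
    have vu: "v \<cdot> u \<in> Hom E X X" and i: "Ident E X \<in> Hom E X X" using that Comp_closed Ident_closed by auto
    have "stable_rel E `` {v \<cdot> u} = stable_rel E `` {Ident E X} \<longleftrightarrow>
        stable_rel E `` {Ident E X} = stable_rel E `` {v \<cdot> u}" by auto
    also have "\<dots> \<longleftrightarrow> (Ident E X, v \<cdot> u) \<in> stable_rel E"
      by (rule eq_equiv_class_iff[OF equiv_stable_rel]) (use vu i in blast)+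
    also have "\<dots> \<longleftrightarrow> (\<exists>h. factors_projective E X X h \<and> Ident E X = v \<cdot> u \<boxplus> h)"
      using stable_relI[OF vu] stable_relE[OF _ disjI1[OF i]] by metis
    finally show ?thesis .
  qed
  have "stable_retract E X Y \<longleftrightarrow> X \<in> Obj E \<and> Y \<in> Obj E \<and>
     (\<exists>u \<in> Hom E X Y. \<exists>v \<in> Hom E Y X. stable_rel E `` {v \<cdot> u} = stable_rel E `` {Ident E X})"
    unfolding stable_retract_def retract_def H using stable_Comp
    by (auto simp: stable_category_def)
  then show ?thesis using * by blast
qed

lemma stable_retract_trans:
  "stable_retract E X Y \<Longrightarrow> stable_retract E Y Z \<Longrightarrow> stable_retract E X Z"
  unfolding stable_retract_def by (rule category.retract_trans[OF category_stable_category])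

lemma retract_stable_retract:
  assumes "retract E X Y" shows "stable_retract E X Y"
proof -
  obtain u v where u: "u \<in> Hom E X Y" "v \<in> Hom E Y X" "v \<cdot> u = Ident E X" and o: "X \<in> Obj E" "Y \<in> Obj E"
    using assms unfolding retract_def by blast
  then have "Ident E X = v \<cdot> u \<boxplus> Zero E X X" using Add_Zero[OF Ident_closed] by simp
  then show ?thesis unfolding stable_retract_iff using u o factors_projective_Zero by blast
qed

section \<open>Splitting off projective summands\<close>

lemma projective_lift:
  assumes "projective E Q" "conflation E X i Y p Z" "f \<in> Hom E Q Z"
  obtains g where "g \<in> Hom E Q Y" "p \<cdot> g = f"
  using assms conflationD[OF assms(2)] conflation_deflation unfolding projective_def by metis

text \<open>Projectivity of Q gives a section s of q. Then q kills the identity minus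
  \<open>s \<cdot> q\<close>, so this difference factors through i, which yields u. The other
  equations follow by cancelling the monic i.\<close>

lemma conflation_split:
  assumes c: "conflation E X i W q Q" and Q: "projective E Q"
  obtains u s where "u \<in> Hom E W X" "s \<in> Hom E Q W"
    "u \<cdot> i = Ident E X" "u \<cdot> s = Zero E Q X" "i \<cdot> u \<boxplus> s \<cdot> q = Ident E W"
proof -
  note D = conflationD[OF c]
  note iX = Ident_closed[OF D(4)] and iW = Ident_closed[OF D(5)] and iQ = Ident_closed[OF D(6)]
  obtain s where s: "s \<in> Hom E Q W" "q \<cdot> s = Ident E Q" using projective_lift[OF Q c iQ] by blast
  note sq = Comp_closed[OF D(2) s(1)]
  obtain e where e: "e \<in> Hom E W W" "e \<boxplus> s \<cdot> q = Ident E W"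
    using difference_exists[OF iW sq] by blast
  have "q \<cdot> e \<boxplus> q = Zero E W Q \<boxplus> q"
    using Comp_Add[OF e(1) sq D(2)] Comp_assoc[OF D(2) s(1) D(2)] s(2) Ident_Comp[OF D(2)]
      Comp_Ident[OF D(2)] Zero_Add[OF D(2)] e(2) by simp
  then have "q \<cdot> e = Zero E W Q"
    by (rule Add_right_cancel[OF Comp_closed[OF e(1) D(2)] Zero_closed[OF D(5,6)] D(2)])
  then obtain u where u: "u \<in> Hom E W X" "i \<cdot> u = e" using conflation_lift[OF c e(1)] by blast
  note iu = Comp_closed[OF u(1) D(1)]
  have eq: "i \<cdot> u \<boxplus> s \<cdot> q = Ident E W" using u(2) e(2) by simp
  have "i \<cdot> u \<cdot> i \<boxplus> s \<cdot> q \<cdot> i = i" using Add_Comp[OF D(1) iu sq] eq Ident_Comp[OF D(1)] by simp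
  then have "i \<cdot> (u \<cdot> i) = i \<cdot> Ident E X"
    using Comp_assoc[OF D(1) u(1) D(1)] Comp_assoc[OF D(1,2) s(1)] D(7) Comp_Zero[OF D(4) s(1)]
      Add_Zero[OF Comp_closed[OF D(1) iu]] Comp_Ident[OF D(1)] by simp
  then have ui: "u \<cdot> i = Ident E X"
    by (rule conflation_mono[OF c Comp_closed[OF D(1) u(1)] iX])
  have "i \<cdot> u \<cdot> s \<boxplus> s \<cdot> q \<cdot> s = s" using Add_Comp[OF s(1) iu sq] eq Ident_Comp[OF s(1)] by simp
  then have "i \<cdot> (u \<cdot> s) \<boxplus> s = Zero E Q W \<boxplus> s"
    using Comp_assoc[OF s(1) u(1) D(1)] Comp_assoc[OF s(1) D(2) s(1)] s(2) Comp_Ident[OF s(1)]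
      Zero_Add[OF s(1)] by simp
  then have "i \<cdot> (u \<cdot> s) = i \<cdot> Zero E Q X"
    using Add_right_cancel[OF Comp_closed[OF Comp_closed[OF s(1) u(1)] D(1)] Zero_closed[OF D(6,5)] s(1)]
      Comp_Zero[OF D(6,1)] by simp
  then have "u \<cdot> s = Zero E Q X"
    by (rule conflation_mono[OF c Comp_closed[OF s(1) u(1)] Zero_closed[OF D(6,4)]])
  then show thesis using that u(1) s(1) ui eq by blast
qed

text \<open>In the splitting, the identity of W differs from \<open>i \<cdot> u\<close> by
  \<open>s \<cdot> q\<close>, which factors through Q.\<close>

lemma stable_retract_kernel:
  assumes c: "conflation E X i W q Q" and Q: "projective E Q"
  shows "stable_retract E W X"
proof -
  note D = conflationD[OF c]
  obtain u s where "u \<in> Hom E W X" "s \<in> Hom E Q W" "i \<cdot> u \<boxplus> s \<cdot> q = Ident E W"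
    using conflation_split[OF assms] by blast
  then show ?thesis
    unfolding stable_retract_iff factors_projective_def using D(1,2,4,5) Q by metis
qed

text \<open>In effect \<open>W = X \<oplus> Q\<close>, and so \<open>C'\<close> is \<open>C \<oplus> Q\<close>.\<close>

lemma pullback_along_split:
  assumes c: "conflation E X i W q Q" and Q: "projective E Q" and p: "conflation E K k C p X"
  obtains C' k' p' where "conflation E K k' C' p' W" "stable_retract E C' C"
proof -
  note D = conflationD[OF c] and F = conflationD[OF p]
  obtain u s where u: "u \<in> Hom E W X" and s: "s \<in> Hom E Q W"
    and us: "u \<cdot> i = Ident E X" "u \<cdot> s = Zero E Q X" "i \<cdot> u \<boxplus> s \<cdot> q = Ident E W"
    using conflation_split[OF c Q] by blast
  \<comment> \<open>Pulling p back along the projection u keeps its kernel K.\<close>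
  obtain C' p' f' k' where S: "pullback_square E C X C' W p u p' f'" and k': "conflation E K k' C' p' W"
    using conflation_pullback[OF p u] by blast
  note T = pullback_squareD[OF S]
  have o: "C' \<in> Obj E" using T Hom_obj by blast
  note ip = Comp_closed[OF F(2) D(1)]
  have "p \<cdot> Ident E C = u \<cdot> (i \<cdot> p)"
    using Comp_assoc[OF F(2) D(1) u] us(1) Ident_Comp[OF F(2)] Comp_Ident[OF F(2)] by simp
  \<comment> \<open>The maps g and t are the inclusions of the summands C and Q, with projections f'
    and \<open>q \<cdot> p'\<close>. The decomposition of the identity is checked on both legs of
    the square.\<close>
  then obtain g where g: "g \<in> Hom E C C'" "f' \<cdot> g = Ident E C" "p' \<cdot> g = i \<cdot> p"
    using pullback_square_lift[OF S Ident_closed[OF F(5)] ip] by blast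
  have "p \<cdot> Zero E Q C = u \<cdot> s" using Comp_Zero[OF D(6) F(2)] us(2) by simp
  then obtain t where t: "t \<in> Hom E Q C'" "f' \<cdot> t = Zero E Q C" "p' \<cdot> t = s"
    using pullback_square_lift[OF S Zero_closed[OF D(6) F(5)] s] by blast
  note qp = Comp_closed[OF T(3) D(2)]
  note gf = Comp_closed[OF T(4) g(1)] and tqp = Comp_closed[OF qp t(1)]
  have "g \<cdot> f' \<boxplus> t \<cdot> (q \<cdot> p') = Ident E C'"
  proof (rule pullback_square_unique[OF S Add_closed[OF gf tqp] Ident_closed[OF o]])
    show "f' \<cdot> (g \<cdot> f' \<boxplus> t \<cdot> (q \<cdot> p')) = f' \<cdot> Ident E C'"
      using Comp_Add[OF gf tqp T(4)] Comp_assoc[OF T(4) g(1) T(4)] Comp_assoc[OF qp t(1) T(4)]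
        g(2) t(2) Ident_Comp[OF T(4)] Zero_Comp[OF F(5) qp] Add_Zero[OF T(4)] Comp_Ident[OF T(4)]
      by simp
    have "p' \<cdot> (g \<cdot> f' \<boxplus> t \<cdot> (q \<cdot> p')) = i \<cdot> (u \<cdot> p') \<boxplus> s \<cdot> (q \<cdot> p')"
      using Comp_Add[OF gf tqp T(3)] Comp_assoc[OF T(4) g(1) T(3)] Comp_assoc[OF qp t(1) T(3)]
        g(3) t(3) Comp_assoc[OF T(4) F(2) D(1)] T(5) by simp
    also have "\<dots> = (i \<cdot> u \<boxplus> s \<cdot> q) \<cdot> p'"
      using Add_Comp[OF T(3) Comp_closed[OF u D(1)] Comp_closed[OF D(2) s]]
        Comp_assoc[OF T(3) u D(1)] Comp_assoc[OF T(3) D(2) s] by simp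
    also have "\<dots> = p' \<cdot> Ident E C'" using us(3) Ident_Comp[OF T(3)] Comp_Ident[OF T(3)] by simp
    finally show "p' \<cdot> (g \<cdot> f' \<boxplus> t \<cdot> (q \<cdot> p')) = p' \<cdot> Ident E C'" .
  qed
  then have "stable_retract E C' C"
    unfolding stable_retract_iff factors_projective_def using o F(5) g(1) T(4) Q qp t(1) by metis
  then show thesis using that k' by blast
qed

section \<open>Syzygies of stable retracts\<close>

lemma syzygy_map:
  assumes c: "conflation E S j Q q X" and Q: "projective E Q" and d: "conflation E S' j' Q' q' X'"
    and f: "f \<in> Hom E X X'"
  obtains F G where "F \<in> Hom E S S'" "G \<in> Hom E Q Q'" "j' \<cdot> F = G \<cdot> j" "q' \<cdot> G = f \<cdot> q"
proof -
  note C = conflationD[OF c] and D = conflationD[OF d]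
  obtain G where G: "G \<in> Hom E Q Q'" "q' \<cdot> G = f \<cdot> q"
    using projective_lift[OF Q d Comp_closed[OF C(2) f]] by blast
  have "q' \<cdot> (G \<cdot> j) = Zero E S X'"
    using Comp_assoc[OF C(1) G(1) D(2)] G(2) Comp_assoc[OF C(1,2) f] C(7) Comp_Zero[OF C(4) f] by simp
  then obtain F where "F \<in> Hom E S S'" "j' \<cdot> F = G \<cdot> j"
    using conflation_lift[OF d Comp_closed[OF C(1) G(1)]] by blast
  then show thesis using that G by blast
qed

text \<open>Lift the maps expressing X as a stable retract to the projective terms. The resulting
  lift of the identity of X differs from the identity of Q by a map into S; restricting to S shows
  that the identity of S is \<open>V \<cdot> U\<close> plus a map through Q.\<close>

lemma stable_retract_syzygy:
  assumes r: "stable_retract E X X'"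
    and c: "conflation E S j Q q X" and Q: "projective E Q"
    and d: "conflation E S' j' Q' q' X'" and Q': "projective E Q'"
  shows "stable_retract E S S'"
proof -
  note C = conflationD[OF c] and D = conflationD[OF d]
  note iQ = Ident_closed[OF C(5)] and iS = Ident_closed[OF C(4)]
  obtain u v R a b where u: "u \<in> Hom E X X'" and v: "v \<in> Hom E X' X"
    and R: "projective E R" "a \<in> Hom E X R" "b \<in> Hom E R X" and eq: "Ident E X = v \<cdot> u \<boxplus> b \<cdot> a"
    using r unfolding stable_retract_iff factors_projective_def by auto
  obtain U U' where U: "U \<in> Hom E S S'" "U' \<in> Hom E Q Q'" "j' \<cdot> U = U' \<cdot> j" "q' \<cdot> U' = u \<cdot> q"
    using syzygy_map[OF c Q d u] by blast
  obtain V V' where V: "V \<in> Hom E S' S" "V' \<in> Hom E Q' Q" "j \<cdot> V = V' \<cdot> j'" "q \<cdot> V' = v \<cdot> q'"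
    using syzygy_map[OF d Q' c v] by blast
  obtain b' where b': "b' \<in> Hom E R Q" "q \<cdot> b' = b" using projective_lift[OF R(1) c R(3)] by blast
  note aq = Comp_closed[OF C(2) R(2)]
  note VU = Comp_closed[OF U(2) V(2)] and baq = Comp_closed[OF aq b'(1)]
  \<comment> \<open>A lift along q of \<open>v \<cdot> u \<boxplus> b \<cdot> a\<close>, the
    identity of X.\<close>
  let ?w = "V' \<cdot> U' \<boxplus> b' \<cdot> (a \<cdot> q)"
  have w: "?w \<in> Hom E Q Q" by (rule Add_closed[OF VU baq])
  have "q \<cdot> ?w = v \<cdot> u \<cdot> q \<boxplus> b \<cdot> a \<cdot> q"
    using Comp_Add[OF VU baq C(2)] Comp_assoc[OF U(2) V(2) C(2)] V(4) Comp_assoc[OF U(2) D(2) v] U(4)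
      Comp_assoc[OF C(2) u v] Comp_assoc[OF aq b'(1) C(2)] b'(2) Comp_assoc[OF C(2) R(2,3)] by simp
  also have "\<dots> = q"
    using Add_Comp[OF C(2) Comp_closed[OF u v] Comp_closed[OF R(2,3)]] eq Ident_Comp[OF C(2)] by simp
  finally have qw: "q \<cdot> ?w = q" .
  obtain e where e: "e \<in> Hom E Q Q" "e \<boxplus> ?w = Ident E Q" using difference_exists[OF iQ w] by blast
  have "q \<cdot> e \<boxplus> q = Zero E Q X \<boxplus> q"
    using Comp_Add[OF e(1) w C(2)] qw e(2) Comp_Ident[OF C(2)] Zero_Add[OF C(2)] by simp
  then have "q \<cdot> e = Zero E Q X"
    by (rule Add_right_cancel[OF Comp_closed[OF e(1) C(2)] Zero_closed[OF C(5,6)] C(2)])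
  then obtain t where t: "t \<in> Hom E Q S" "j \<cdot> t = e" using conflation_lift[OF c e(1)] by blast
  note vu = Comp_closed[OF U(1) V(1)] and tj = Comp_closed[OF C(1) t(1)]
  have "V' \<cdot> U' \<cdot> j = V' \<cdot> j' \<cdot> U" using Comp_assoc[OF C(1) U(2) V(2)] U(3) Comp_assoc[OF U(1) D(1) V(2)] by simp
  also have "\<dots> = j \<cdot> (V \<cdot> U)" using V(3) Comp_assoc[OF U(1) V(1) C(1)] by simp
  finally have 1: "V' \<cdot> U' \<cdot> j = j \<cdot> (V \<cdot> U)" .
  \<comment> \<open>The correction through R was lifted with its factor q kept, so it vanishes on
    S.\<close>
  have 2: "b' \<cdot> (a \<cdot> q) \<cdot> j = Zero E S Q"
    using Comp_assoc[OF C(1) aq b'(1)] Comp_assoc[OF C(1,2) R(2)] C(7)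
      Comp_Zero[OF C(4) R(2)] Comp_Zero[OF C(4) b'(1)] by simp
  have wj: "?w \<cdot> j = j \<cdot> (V \<cdot> U)"
    unfolding Add_Comp[OF C(1) VU baq] 1 2 by (rule Add_Zero[OF Comp_closed[OF vu C(1)]])
  have "j \<cdot> Ident E S = (e \<boxplus> ?w) \<cdot> j" using e(2) Comp_Ident[OF C(1)] Ident_Comp[OF C(1)] by simp
  also have "\<dots> = j \<cdot> (t \<cdot> j) \<boxplus> j \<cdot> (V \<cdot> U)"
    using Add_Comp[OF C(1) e(1) w] wj t(2) Comp_assoc[OF C(1) t(1) C(1)] by simp
  also have "\<dots> = j \<cdot> (V \<cdot> U \<boxplus> t \<cdot> j)"
    using Comp_Add[OF vu tj C(1)] Add_commute[OF Comp_closed[OF vu C(1)] Comp_closed[OF tj C(1)]] by simp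
  finally have "Ident E S = V \<cdot> U \<boxplus> t \<cdot> j" by (rule conflation_mono[OF c iS Add_closed[OF vu tj]])
  then show ?thesis
    unfolding stable_retract_iff factors_projective_def using C(1,4) D(4) U(1) V(1) Q t(1) by metis
qed

end

section \<open>Delooping levels\<close>

lemma Inf_enat_mem:
  fixes A :: "enat set"
  assumes "A \<noteq> {}" shows "Inf A \<in> A"
proof -
  obtain x where "x \<in> A" using assms by blast
  then have "(LEAST x. x \<in> A) \<in> A" by (rule LeastI)
  then show ?thesis unfolding Inf_enat_def using assms by simp
qed

text \<open>A finite bound rules out the empty set, whose infimum is \<open>\<infinity>\<close>, and
  a nonempty set of \<open>enat\<close> attains its infimum.\<close>

lemma Inf_enat_le_iff: "Inf {enat n |n. Q n} \<le> enat m \<longleftrightarrow> (\<exists>n\<le>m. Q n)" (is "Inf ?A \<le> _ \<longleftrightarrow> _")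
proof
  assume le: "Inf ?A \<le> enat m"
  have "?A \<noteq> {}"
  proof
    assume "?A = {}"
    then have "Inf ?A = \<infinity>" unfolding Inf_enat_def by (rule if_P)
    then show False using le by simp
  qed
  then have "Inf ?A \<in> ?A" by (rule Inf_enat_mem)
  then obtain n where n: "Inf ?A = enat n" "Q n" by blast
  show "\<exists>n\<le>m. Q n" using le n(2) unfolding n(1) by auto
next
  assume "\<exists>n\<le>m. Q n"
  then obtain n where n: "n \<le> m" "Q n" by blast
  then have "Inf ?A \<le> enat n" by (intro Inf_lower) blast
  also have "enat n \<le> enat m" using n(1) by simp
  finally show "Inf ?A \<le> enat m" .
qed

text \<open>
  The resolutions that witness \<open>ddell E \<Omega> k X \<le> m\<close>, built by adding one conflation at a time: since
  the bounds involve only \<open>i + k\<close> and \<open>m - i\<close>, removing \<open>C 0\<close> from a witness for \<open>(k, Suc m)\<close> leaves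
  a witness for \<open>(Suc k, m)\<close>.
\<close>

inductive ddell_le :: "('o, 'm, 'z) exact_cat_scheme \<Rightarrow> ('o \<Rightarrow> 'o) \<Rightarrow> nat \<Rightarrow> nat \<Rightarrow> 'o \<Rightarrow> bool"
  for E \<Omega> where
  base: "\<lbrakk>X \<in> Obj E; dell E \<Omega> k X \<le> enat m\<rbrakk> \<Longrightarrow> ddell_le E \<Omega> k m X"
| step: "\<lbrakk>conflation E K i C p X; dell E \<Omega> k C \<le> enat (Suc m); ddell_le E \<Omega> (Suc k) m K\<rbrakk> \<Longrightarrow>
    ddell_le E \<Omega> k (Suc m) X"

lemma ddell_le_mono:
  assumes "ddell_le E \<Omega> k m X" "m \<le> n"
  shows "ddell_le E \<Omega> k n X"
  using assms
proof (induction arbitrary: n)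
  case (base X k m)
  then show ?case by (meson ddell_le.base enat_ord_simps(1) order_trans)
next
  case (step K i C p X k m)
  then obtain l where l: "n = Suc l" "m \<le> l" by (cases n) auto
  have "dell E \<Omega> k C \<le> enat (Suc l)"
    using step.hyps(2) l(2) by (meson Suc_le_mono enat_ord_simps(1) order_trans)
  then show ?case using ddell_le.step step.hyps(1) step.IH[OF l(2)] l(1) by metis
qed

lemma ddell_le_spliced:
  assumes "ddell_le E \<Omega> k m X"
  shows "\<exists>t\<le>m. \<exists>C Z j q. Z 0 = X \<and> Z t = C t \<and>
    (\<forall>i<t. conflation E (Z (Suc i)) (j i) (C i) (q i) (Z i)) \<and>
    (\<forall>i\<le>t. dell E \<Omega> (i + k) (C i) \<le> enat (m - i))"
  using assms
proof induction
  case (base X k m)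
  then show ?case by (intro exI[of _ 0]) auto
next
  case (step K i0 C0 p X k m)
  obtain t C Z j q where t: "t \<le> m" "Z 0 = K" "Z t = C t"
    "\<forall>i<t. conflation E (Z (Suc i)) (j i) (C i) (q i) (Z i)"
    "\<forall>i\<le>t. dell E \<Omega> (i + Suc k) (C i) \<le> enat (m - i)" using step.IH by blast
  \<comment> \<open>\<open>case_nat\<close> puts the new conflation at index 0 and shifts the
    resolution of K by one. The bounds agree because \<open>i + Suc k = Suc i + k\<close> and
    \<open>m - i = Suc m - Suc i\<close>.\<close>
  have "conflation E (case_nat X Z (Suc i)) (case_nat i0 j i) (case_nat C0 C i) (case_nat p q i) (case_nat X Z i)"
    if "i < Suc t" for i using that t step.hyps(1) by (cases i) auto
  moreover have "dell E \<Omega> (i + k) (case_nat C0 C i) \<le> enat (Suc m - i)" if "i \<le> Suc t" for i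
    using that t step.hyps(2) by (cases i) auto
  ultimately show ?case using t(1,3)
    by (intro exI[of _ "Suc t"] conjI exI[of _ "case_nat C0 C"] exI[of _ "case_nat X Z"]
        exI[of _ "case_nat i0 j"] exI[of _ "case_nat p q"]) auto
qed


section \<open>Delooping levels for chosen syzygies\<close>

locale syzygy_category = exact_category E
  for E :: "('o, 'm, 'z) exact_cat_scheme" (structure) +
  fixes \<Omega> P :: "'o \<Rightarrow> 'o" and \<iota> \<pi> :: "'o \<Rightarrow> 'm"
  assumes syzygies: "syzygy_choice E \<Omega> \<iota> P \<pi>"
begin

lemma syzygy_conflation: "X \<in> Obj E \<Longrightarrow> conflation E (\<Omega> X) (\<iota> X) (P X) (\<pi> X) X"
  and projective_cover: "X \<in> Obj E \<Longrightarrow> projective E (P X)"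
  using syzygies unfolding syzygy_choice_def by blast+

lemma stable_retract_Obj: "stable_retract E X Y \<Longrightarrow> X \<in> Obj E \<and> Y \<in> Obj E"
  unfolding stable_retract_iff by blast

lemma stable_retract_funpow:
  "stable_retract E X Y \<Longrightarrow> stable_retract E ((\<Omega> ^^ n) X) ((\<Omega> ^^ n) Y)"
proof (induction n)
  case (Suc n)
  let ?X = "(\<Omega> ^^ n) X" and ?Y = "(\<Omega> ^^ n) Y"
  have r: "stable_retract E ?X ?Y" using Suc by blast
  note o = stable_retract_Obj[OF r]
  have "stable_retract E (\<Omega> ?X) (\<Omega> ?Y)"
    by (rule stable_retract_syzygy[OF r syzygy_conflation projective_cover syzygy_conflation projective_cover])
      (use o in blast)+
  then show ?case by simp
qed simp

text \<open>A witness at a smaller n' becomes one at n itself on applying \<open>\<Omega>\<close>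
  another n - n' times, since \<open>\<Omega>\<close> preserves stable retracts. So n can be kept
  fixed from here on.\<close>

lemma dell_le_iff:
  "dell E \<Omega> k X \<le> enat n \<longleftrightarrow> (\<exists>Y \<in> Obj E. stable_retract E ((\<Omega> ^^ n) X) ((\<Omega> ^^ (n + k)) Y))"
proof
  assume "dell E \<Omega> k X \<le> enat n"
  then obtain n' Y where n': "n' \<le> n" "Y \<in> Obj E" "stable_retract E ((\<Omega> ^^ n') X) ((\<Omega> ^^ (n' + k)) Y)"
    unfolding dell_def Inf_enat_le_iff by blast
  then have "stable_retract E ((\<Omega> ^^ (n - n' + n')) X) ((\<Omega> ^^ (n - n' + (n' + k))) Y)"
    using stable_retract_funpow[OF n'(3), of "n - n'"] unfolding funpow_add o_apply by simp
  then show "\<exists>Y \<in> Obj E. stable_retract E ((\<Omega> ^^ n) X) ((\<Omega> ^^ (n + k)) Y)" using n' by auto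
next
  assume "\<exists>Y \<in> Obj E. stable_retract E ((\<Omega> ^^ n) X) ((\<Omega> ^^ (n + k)) Y)"
  then show "dell E \<Omega> k X \<le> enat n" unfolding dell_def Inf_enat_le_iff by blast
qed

lemma dell_le_stable_retract:
  assumes "stable_retract E X X'" "dell E \<Omega> k X' \<le> enat n"
  shows "dell E \<Omega> k X \<le> enat n"
proof -
  obtain Y where "Y \<in> Obj E" "stable_retract E ((\<Omega> ^^ n) X') ((\<Omega> ^^ (n + k)) Y)"
    using assms(2) unfolding dell_le_iff by blast
  then show ?thesis
    using stable_retract_trans[OF stable_retract_funpow[OF assms(1)]] unfolding dell_le_iff by meson
qed

text \<open>The same Y serves: one more \<open>\<Omega>\<close> on both sides is absorbed by X on
  the left and by k on the right.\<close>

lemma dell_le_syzygy: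
  assumes "dell E \<Omega> k X \<le> enat n"
  shows "dell E \<Omega> (Suc k) (\<Omega> X) \<le> enat n"
proof -
  obtain Y where Y: "Y \<in> Obj E" "stable_retract E ((\<Omega> ^^ n) X) ((\<Omega> ^^ (n + k)) Y)"
    using assms unfolding dell_le_iff by blast
  have "stable_retract E ((\<Omega> ^^ n) (\<Omega> X)) ((\<Omega> ^^ (n + Suc k)) Y)"
    using stable_retract_funpow[OF Y(2), of 1] by (simp add: funpow_swap1)
  then show ?thesis using Y(1) unfolding dell_le_iff by blast
qed

lemma ddell_le_iff:
  assumes X: "X \<in> Obj E"
  shows "ddell E \<Omega> k X \<le> enat m \<longleftrightarrow> ddell_le E \<Omega> k m X"
proof
  assume "ddell E \<Omega> k X \<le> enat m"
  then obtain n t C d where n: "n \<le> m" "t \<le> n" and ex: "admissibly_exact E t C d X"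
    and dell: "\<forall>i\<le>t. dell E \<Omega> (i + k) (C i) \<le> enat (n - i)"
    unfolding ddell_def Inf_enat_le_iff by blast
  have "ddell_le E \<Omega> k n X"
  proof (cases "t = 0")
    case True
    then have "is_iso E (C 0) X (d 0)" using ex unfolding admissibly_exact_def by simp
    then have "stable_retract E X (C 0)"
      by (rule retract_stable_retract[OF is_iso_retract[OF category_axioms]])
    moreover have "dell E \<Omega> k (C 0) \<le> enat n" using dell by force
    ultimately show ?thesis by (intro ddell_le.base[OF X]) (rule dell_le_stable_retract)
  next
    case False
    then obtain Z j q where Z: "Z 0 = X" "Z t = C t"
      "\<forall>i<t. conflation E (Z (i + 1)) (j i) (C i) (q i) (Z i)"
      using ex unfolding admissibly_exact_def by auto
    have o: "Z t \<in> Obj E"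
      using conflationD(4) Z(3) False
      by (metis Suc_eq_plus1 lessI not0_implies_Suc)
    \<comment> \<open>Downward induction from \<open>Z t = C t\<close>: the part of the sequence
      from index i on resolves \<open>Z i\<close> with both parameters shifted by i.\<close>
    have "ddell_le E \<Omega> (i + k) (n - i) (Z i)" if "i \<le> t" for i
      using that
    proof (induction rule: inc_induct)
      case base
      show ?case using ddell_le.base[OF o] dell Z(2) by simp
    next
      case (step i)
      \<comment> \<open>Here i < t \<le> n, so the truncated subtraction is a true successor, as the
        rule \<open>ddell_le.step\<close> demands.\<close>
      then have i: "n - i = Suc (n - Suc i)" using n(2) by linarith
      show ?case
        unfolding i
        by (rule ddell_le.step[of E "Z (i + 1)" "j i" "C i" "q i"])
          (use step Z(3) dell i in \<open>auto simp flip: i\<close>)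
    qed
    from this[of 0] show ?thesis using Z(1) by simp
  qed
  then show "ddell_le E \<Omega> k m X" by (rule ddell_le_mono[OF _ n(1)])
next
  assume le: "ddell_le E \<Omega> k m X"
  obtain t C Z j q where t: "t \<le> m" "Z 0 = X" "Z t = C t"
    "\<forall>i<t. conflation E (Z (Suc i)) (j i) (C i) (q i) (Z i)"
    "\<forall>i\<le>t. dell E \<Omega> (i + k) (C i) \<le> enat (m - i)"
    using ddell_le_spliced[OF le] by metis
  have "\<exists>d. admissibly_exact E t C d X"
  proof (cases "t = 0")
    case True
    then show ?thesis
      unfolding admissibly_exact_def using t(2,3) Ident_iso[OF X] by (intro exI[of _ "\<lambda>_. Ident E X"]) simp
  next
    case False
    \<comment> \<open>The spliced maps; at i = t there is no further deflation, only the last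
      inclusion.\<close>
    let ?d = "\<lambda>i. if i = 0 then q 0 else if i < t then j (i - 1) \<cdot> q i else j (t - 1)"
    have "admissibly_exact E t C ?d X"
      unfolding admissibly_exact_def if_not_P[OF False]
      by (intro exI[of _ Z] exI[of _ j] exI[of _ q]) (use False t in simp)
    then show ?thesis by blast
  qed
  then obtain d where d: "admissibly_exact E t C d X" ..
  have "\<exists>t\<le>m. \<exists>C d. admissibly_exact E t C d X \<and> (\<forall>i\<le>t. dell E \<Omega> (i + k) (C i) \<le> enat (m - i))"
    by (intro exI[of _ t] exI[of _ C] exI[of _ d] conjI t(1,5) d)
  then show "ddell E \<Omega> k X \<le> enat m" unfolding ddell_def Inf_enat_le_iff by (intro exI[of _ m]) simp
qed

text \<open>
  Composing \<open>P C \<rightarrow> C \<rightarrow> X\<close> gives a syzygy \<open>L\<close> of \<open>X\<close> that is an extension of \<open>K\<close> by \<open>\<Omega> C\<close>; rotating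
  this extension turns it into a deflation onto \<open>L\<close> whose kernel is a syzygy of \<open>K\<close>.
\<close>

lemma ddell_le_syzygy:
  assumes "ddell_le E \<Omega> k m X"
  shows "\<exists>S j Q q. projective E Q \<and> conflation E S j Q q X \<and> ddell_le E \<Omega> (Suc k) m S"
  using assms
proof induction
  case (base X k m)
  have "\<Omega> X \<in> Obj E" using conflationD(4) syzygy_conflation base.hyps(1) by blast
  then have "ddell_le E \<Omega> (Suc k) m (\<Omega> X)"
    by (rule ddell_le.base[OF _ dell_le_syzygy[OF base.hyps(2)]])
  then show ?case using syzygy_conflation projective_cover base.hyps(1) by blast
next
  case (step K i C p X k m)
  obtain S j Q q where S: "projective E Q" "conflation E S j Q q K" "ddell_le E \<Omega> (Suc (Suc k)) m S"
    using step.IH by blast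
  have C: "C \<in> Obj E" using conflationD(5)[OF step.hyps(1)] .
  obtain L l a b where L: "conflation E L l (P C) (p \<cdot> \<pi> C) X" "conflation E (\<Omega> C) a L b K"
    by (rule conflation_compose[OF syzygy_conflation[OF C] step.hyps(1)])
  obtain W i' p' j' q' where W: "conflation E (\<Omega> C) i' W p' Q" "conflation E S j' W q' L"
    by (rule conflation_bicartesian[OF L(2) S(2)])
  \<comment> \<open>Since Q is projective, W is a stable retract of \<open>\<Omega> C\<close>. So W
    can be the first term of a resolution of L, followed by that of S.\<close>
  have "dell E \<Omega> (Suc k) W \<le> enat (Suc m)"
    by (rule dell_le_stable_retract[OF stable_retract_kernel[OF W(1) S(1)] dell_le_syzygy[OF step.hyps(2)]])
  then have "ddell_le E \<Omega> (Suc k) (Suc m) L" by (rule ddell_le.step[OF W(2) _ S(3)])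
  then show ?case using L(1) projective_cover[OF C] by blast
qed

text \<open>Y, Z and the maps vary in the induction because the recursive call concerns the
  extension of S by K at \<open>Suc k\<close>; n stays fixed because S inherits the bound n from
  Z.\<close>

lemma ddell_le_extension:
  assumes "ddell_le E \<Omega> k m X" "conflation E X f Y g Z" "ddell_le E \<Omega> k n Z"
  shows "ddell_le E \<Omega> k (Suc (m + n)) Y"
  using assms
proof (induction arbitrary: Y Z f g)
  case (base X k m)
  obtain S j Q q where S: "projective E Q" "conflation E S j Q q Z" "ddell_le E \<Omega> (Suc k) n S"
    using ddell_le_syzygy[OF base.prems(2)] by blast
  obtain W i' p' j' q' where W: "conflation E X i' W p' Q" "conflation E S j' W q' Y"
    by (rule conflation_bicartesian[OF base.prems(1) S(2)])
  \<comment> \<open>W is X plus a projective, so its bound is that of X; its kernel over Y is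
    S.\<close>
  have "dell E \<Omega> k W \<le> enat m"
    by (rule dell_le_stable_retract[OF stable_retract_kernel[OF W(1) S(1)] base.hyps(2)])
  also have "enat m \<le> enat (Suc (m + n))" by simp
  finally show ?case by (rule ddell_le.step[OF W(2) _ ddell_le_mono[OF S(3)]]) simp
next
  case (step K i C p X k m)
  obtain S j Q q where S: "projective E Q" "conflation E S j Q q Z" "ddell_le E \<Omega> (Suc k) n S"
    using ddell_le_syzygy[OF step.prems(2)] by blast
  obtain W i' p' j' q' where W: "conflation E X i' W p' Q" "conflation E S j' W q' Y"
    by (rule conflation_bicartesian[OF step.prems(1) S(2)])
  obtain C' k' c' where C': "conflation E K k' C' c' W" "stable_retract E C' C"
    by (rule pullback_along_split[OF W(1) S(1) step.hyps(1)])
  obtain K' l a b where K': "conflation E K' l C' (q' \<cdot> c') Y" "conflation E K a K' b S"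
    by (rule conflation_compose[OF C'(1) W(2)])
  have "dell E \<Omega> k C' \<le> enat (Suc m)" by (rule dell_le_stable_retract[OF C'(2) step.hyps(2)])
  also have "enat (Suc m) \<le> enat (Suc (Suc m + n))" by simp
  \<comment> \<open>The induction hypothesis bounds K' by \<open>Suc (m + n)\<close>, which equals
    \<open>Suc m + n\<close>, exactly one less than the bound claimed for Y.\<close>
  finally show ?case using ddell_le.step[OF K'(1) _ step.IH[OF K'(2) S(3)]] by simp
qed

end

theorem theorem3p4:
  fixes E :: "('o, 'm, 'z) exact_cat_scheme"
    and \<Omega> P :: "'o \<Rightarrow> 'o" and \<iota> \<pi> :: "'o \<Rightarrow> 'm"
    and X Y Z :: 'o and f g :: 'm and k :: nat
  assumes "exact_category E"
    and "idempotent_complete E"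
    and "enough_projectives E"
    and "syzygy_choice E \<Omega> \<iota> P \<pi>"
    and "conflation E X f Y g Z"
    and "k \<ge> 1"
  shows "ddell E \<Omega> k Y \<le> ddell E \<Omega> k X + ddell E \<Omega> k Z + 1"
proof -
  interpret exact_category E by (rule assms)
  interpret syzygy_category E \<Omega> P \<iota> \<pi> by unfold_locales (rule assms)
  note o = conflationD(4-6)[OF assms(5)]
  show ?thesis
  \<comment> \<open>If either level is infinite, so is the right-hand side; otherwise both levels
    are natural numbers.\<close>
  proof (cases "ddell E \<Omega> k X = \<infinity> \<or> ddell E \<Omega> k Z = \<infinity>")
    case False
    then obtain m n where mn: "ddell E \<Omega> k X = enat m" "ddell E \<Omega> k Z = enat n" by auto
    then have "ddell_le E \<Omega> k m X" "ddell_le E \<Omega> k n Z"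
      using ddell_le_iff[OF o(1), of k m] ddell_le_iff[OF o(3), of k n] by simp_all
    then have "ddell_le E \<Omega> k (Suc (m + n)) Y" by (rule ddell_le_extension[OF _ assms(5)])
    then have "ddell E \<Omega> k Y \<le> enat (Suc (m + n))" using ddell_le_iff[OF o(2)] by simp
    then show ?thesis using mn by (simp add: one_enat_def)
  qed auto
qed

end
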